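(* Let $\lambda$ and $\mu$ be two partitions of lengths $m$ and $n$ respectively. Then $$s_\lambda s_\mu=\sum_{M,N} C_{MN}\,s_{(\lambda+M,\ \mu-N)},$$ where $M$ and $N$ run over $\mathbb Z_{\ge0}^m$ and $\mathbb Z_{\ge0}^n$, and $C_{MN}$ is the number of $m\times n$ matrices $(k_{ij})$ of nonnegative integers such that $$(k_{11}+k_{12}+\cdots+k_{1n},\ \dots,\ k_{m1}+\cdots+k_{mn})=M,$$ $$(k_{11}+k_{21}+\cdots+k_{m1},\ \dots,\ k_{1n}+k_{2n}+\cdots+k_{mn})=N.$$ In particular the Schur functions form a $\mathbb Z$-basis of $\Lambda$.
   Context: $\Lambda$ is the ring of symmetric functions in infinitely many variables with integer coefficients; $s_\lambda$ is the Schur function of a partition $\lambda$. $(\kappa,\rho)$ denotes the juxtaposition (concatenation) of tuples. For an arbitrary integer tuple $\nu=(\nu_1,\dots,\nu_l)$, with $\delta=(l-1,\dots,1,0)$, the Schur function $s_\nu$ is defined as $S_{-\nu_1}\cdots S_{-\nu_l}.1$, where $S(z)=\exp(\sum_{n\ge1}\frac{b_{-n}}{n}z^n)\exp(-\sum_{n\ge1}\frac{b_n}{n}z^{-n})=\sum_{n\in\mathbb Z} S_nz^{-n}$ acts on $\mathrm{Sym}(b_{-n}\text{'s},n\ge1)$, $b_{-n}$ acting by multiplication and $b_n$ by $n\,\partial/\partial b_{-n}$ for $n\ge1$, and $b_{-n}$ is identified with the power sum $p_n$. Equivalently, $s_\nu=(-1)^{l(\sigma)}s_\rho$ if $\nu+\delta$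 has distinct entries and $\rho=\sigma(\nu+\delta)-\delta$ is a partition (with nonnegative parts) for some permutation $\sigma$ of length $l(\sigma)$, and $s_\nu=0$ otherwise. *)

theory Defs
  imports Complex_Main "HOL-Library.Poly_Mapping" "HOL-Library.FuncSet"
begin

section \<open>Formal power series in infinitely many variables\<close>

text \<open>
  A monomial in variables indexed by \<^typ>\<open>nat\<close> is its exponent vector
  \<^typ>\<open>nat \<Rightarrow>\<^sub>0 nat\<close>. A series is an arbitrary coefficient function on monomials.
\<close>

typedef 'a mfps = "UNIV :: ((nat \<Rightarrow>\<^sub>0 nat) \<Rightarrow> 'a) set"
  morphisms coeff Abs_mfps ..

lemma coeff_Abs_mfps [simp]: "coeff (Abs_mfps f) = f"
  by (simp add: Abs_mfps_inverse)

lemma mfps_eqI: "(\<And>m. coeff f m = coeff g m) \<Longrightarrow> f = g"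
  by (metis coeff_inject ext)

lemma finite_summands: "finite {a :: nat \<Rightarrow>\<^sub>0 nat. \<exists>b. a + b = m}"
proof -
  let ?F = "{f. \<forall>i. (i \<in> Poly_Mapping.keys m
      \<longrightarrow> f i \<in> {..sum (Poly_Mapping.lookup m) (Poly_Mapping.keys m)})
    \<and> (i \<notin> Poly_Mapping.keys m \<longrightarrow> f i = (0::nat))}"
  have "Poly_Mapping.lookup ` {a. \<exists>b. a + b = m} \<subseteq> ?F"
  proof
    fix f assume "f \<in> Poly_Mapping.lookup ` {a. \<exists>b. a + b = m}"
    then obtain a b where f: "f = Poly_Mapping.lookup a" and ab: "a + b = m" by auto
    have le: "f i \<le> Poly_Mapping.lookup m i" for i
      by (simp add: f ab [symmetric] lookup_add)
    have "f i \<le> sum (Poly_Mapping.lookup m) (Poly_Mapping.keys m)"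
      if "i \<in> Poly_Mapping.keys m" for i
      using le [of i] member_le_sum [of i "Poly_Mapping.keys m" "Poly_Mapping.lookup m"] that
      by simp
    moreover have "f i = 0" if "i \<notin> Poly_Mapping.keys m" for i
      using le [of i] that by (simp add: in_keys_iff)
    ultimately show "f \<in> ?F" by simp
  qed
  moreover have "finite ?F"
    by (rule finite_set_of_finite_funs) auto
  ultimately have "finite (Poly_Mapping.lookup ` {a. \<exists>b. a + b = m})"
    by (rule finite_subset)
  then show ?thesis
    by (rule finite_imageD) (auto intro!: inj_onI poly_mapping_eqI)
qed

lemma finite_splits: "finite {(a, b :: nat \<Rightarrow>\<^sub>0 nat). a + b = m}"
proof (rule finite_subset)
  show "{(a, b). a + b = m} \<subseteq> {a. \<exists>b. a + b = m} \<times> {a. \<exists>b. a + b = m}"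
    by (auto, metis add.commute)
  show "finite ({a. \<exists>b. a + b = m} \<times> {a. \<exists>b. a + b = m})"
    by (simp add: finite_summands)
qed

instantiation mfps :: (comm_ring_1) comm_ring_1
begin

definition "0 = Abs_mfps (\<lambda>m. 0)"
definition "1 = Abs_mfps (\<lambda>m. if m = 0 then 1 else 0)"
definition "f + g = Abs_mfps (\<lambda>m. coeff f m + coeff g m)"
definition "f - g = Abs_mfps (\<lambda>m. coeff f m - coeff g m)"
definition "- f = Abs_mfps (\<lambda>m. - coeff f m)"
definition "f * g = Abs_mfps (\<lambda>m. \<Sum>(a, b) \<in> {(a, b). a + b = m}. coeff f a * coeff g b)"

lemma coeff_simps:
  "coeff 0 m = 0"
  "coeff (f + g) m = coeff f m + coeff g m"
  "coeff (f - g) m = coeff f m - coeff g m"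
  "coeff (- f) m = - coeff f m"
  by (simp_all add: zero_mfps_def plus_mfps_def minus_mfps_def uminus_mfps_def)

lemma coeff_one: "coeff 1 m = (if m = 0 then 1 else 0)"
  by (simp add: one_mfps_def)

lemma coeff_mult:
  "coeff (f * g) m = (\<Sum>(a, b) \<in> {(a, b). a + b = m}. coeff f a * coeff g b)"
  by (simp add: times_mfps_def)

instance
proof
  fix f g h :: "'a mfps"
  show "f * g * h = f * (g * h)"
  proof (rule mfps_eqI)
    fix m
    let ?D = "\<lambda>m :: nat \<Rightarrow>\<^sub>0 nat. {(a, b). a + b = m}"
    have "coeff (f * g * h) m =
        (\<Sum>x \<in> ?D m. \<Sum>y \<in> ?D (fst x). coeff f (fst y) * coeff g (snd y) * coeff h (snd x))"
      by (simp add: coeff_mult case_prod_unfold sum_distrib_right)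
    also have "\<dots> = (\<Sum>(x, y) \<in> Sigma (?D m) (\<lambda>x. ?D (fst x)).
        coeff f (fst y) * coeff g (snd y) * coeff h (snd x))"
      by (rule sum.Sigma) (auto intro: finite_splits)
    also have "\<dots> = (\<Sum>(x, y) \<in> Sigma (?D m) (\<lambda>x. ?D (snd x)).
        coeff f (fst x) * (coeff g (fst y) * coeff h (snd y)))"
      by (rule sum.reindex_bij_witness
            [where i = "\<lambda>(x, y). ((fst x + fst y, snd y), (fst x, fst y))"
              and j = "\<lambda>(x, y). ((fst y, snd y + snd x), (snd y, snd x))"])
        (auto simp: algebra_simps)
    also have "\<dots> = (\<Sum>x \<in> ?D m. \<Sum>y \<in> ?D (snd x).
        coeff f (fst x) * (coeff g (fst y) * coeff h (snd y)))"
      by (rule sum.Sigma [symmetric]) (auto intro: finite_splits)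
    also have "\<dots> = coeff (f * (g * h)) m"
      by (simp add: coeff_mult case_prod_unfold sum_distrib_left)
    finally show "coeff (f * g * h) m = coeff (f * (g * h)) m" .
  qed
  show "f * g = g * f"
  proof (rule mfps_eqI)
    fix m
    show "coeff (f * g) m = coeff (g * f) m"
      unfolding coeff_mult
      by (rule sum.reindex_bij_witness [where i = prod.swap and j = prod.swap])
        (auto simp: algebra_simps)
  qed
  show "1 * f = f"
  proof (rule mfps_eqI)
    fix m
    have "coeff (1 * f) m = (\<Sum>x \<in> {(0, m)}. coeff 1 (fst x) * coeff f (snd x))"
      unfolding coeff_mult case_prod_unfold
      by (rule sum.mono_neutral_right)
        (use finite_splits [of m] in \<open>auto simp: coeff_one case_prod_unfold\<close>)
    then show "coeff (1 * f) m = coeff f m"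
      by (simp add: coeff_one)
  qed
  show "(f + g) * h = f * h + g * h"
    by (rule mfps_eqI)
      (simp add: coeff_mult coeff_simps case_prod_unfold distrib_right sum.distrib)
  show "(0 :: 'a mfps) \<noteq> 1"
    by (metis coeff_simps(1) coeff_one zero_neq_one)
qed (auto intro!: mfps_eqI simp: coeff_simps)

end

definition mfps_const :: "'a \<Rightarrow> 'a :: comm_ring_1 mfps" where
  "mfps_const c = Abs_mfps (\<lambda>m. if m = 0 then c else 0)"


section \<open>Symmetric functions\<close>

definition monom_degree :: "(nat \<Rightarrow>\<^sub>0 nat) \<Rightarrow> nat" where
  "monom_degree m = (\<Sum>i \<in> Poly_Mapping.keys m. Poly_Mapping.lookup m i)"

text \<open>The ring \<open>\<Lambda>\<close>, realised inside the series with rational coefficients.\<close>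

definition Lambda :: "rat mfps set" where
  "Lambda = {f.
     (\<forall>\<pi> m. bij \<pi> \<longrightarrow> coeff f (Poly_Mapping.map_key \<pi> m) = coeff f m) \<and>
     (\<exists>d. \<forall>m. coeff f m \<noteq> 0 \<longrightarrow> monom_degree m \<le> d) \<and>
     (\<forall>m. coeff f m \<in> \<int>)}"

definition power_sum :: "nat \<Rightarrow> rat mfps" where
  "power_sum n = Abs_mfps (\<lambda>m. if \<exists>i. m = Poly_Mapping.single i n then 1 else 0)"


section \<open>The vertex operator\<close>

text \<open>
  \<open>Sym(b\<^bsub>-n\<^esub>'s, n \<ge> 1)\<close> is the polynomial ring over the rationals whose variable of index
  \<open>i\<close> is \<open>b\<^bsub>-(i+1)\<^esub>\<close>.
\<close>

type_synonym fock = "(nat \<Rightarrow>\<^sub>0 nat) \<Rightarrow>\<^sub>0 rat"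

definition fock_scale :: "rat \<Rightarrow> fock \<Rightarrow> fock" where
  "fock_scale c f = Poly_Mapping.single 0 c * f"

definition pderivative :: "nat \<Rightarrow> fock \<Rightarrow> fock" where
  "pderivative i f = (\<Sum>m \<in> Poly_Mapping.keys f.
     Poly_Mapping.single (m - Poly_Mapping.single i 1)
       (of_nat (Poly_Mapping.lookup m i) * Poly_Mapping.lookup f m))"

text \<open>The operators \<open>b\<^bsub>-n\<^esub>\<close> and \<open>b\<^sub>n\<close>; both are meant for \<open>n \<ge> 1\<close> only.\<close>

definition creation :: "nat \<Rightarrow> fock \<Rightarrow> fock" where
  "creation n f = Poly_Mapping.single (Poly_Mapping.single (n - 1) 1) 1 * f"

definition annihilation :: "nat \<Rightarrow> fock \<Rightarrow> fock" where
  "annihilation n f = fock_scale (of_nat n) (pderivative (n - 1) f)"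

text \<open>
  A formal power series in one variable \<open>t\<close> with operator coefficients is the function giving
  the coefficient of \<open>t\<^sup>n\<close>; the variable will be \<open>z\<close> for the first exponential and \<open>z\<^sup>-\<^sup>1\<close> for
  the second.
\<close>

type_synonym op_series = "nat \<Rightarrow> fock \<Rightarrow> fock"

definition op_one :: op_series where
  "op_one n f = (if n = 0 then f else 0)"

definition op_mult :: "op_series \<Rightarrow> op_series \<Rightarrow> op_series" where
  "op_mult A B n f = (\<Sum>i\<le>n. A i (B (n - i) f))"

text \<open>
  \<open>\<Sum>k. A\<^sup>k / k!\<close>, for \<open>A\<close> without constant term: then \<open>A\<^sup>k\<close> has no terms below \<open>t\<^sup>k\<close>, so the
  coefficient of \<open>t\<^sup>n\<close> only involves \<open>k \<le> n\<close>.
\<close>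

definition op_exp :: "op_series \<Rightarrow> op_series" where
  "op_exp A n f = (\<Sum>k\<le>n. fock_scale (1 / fact k) ((op_mult A ^^ k) op_one n f))"

definition E_plus :: op_series where
  "E_plus = op_exp (\<lambda>n f. if n = 0 then 0 else fock_scale (1 / of_nat n) (creation n f))"

definition E_minus :: op_series where
  "E_minus = op_exp (\<lambda>n f. if n = 0 then 0 else - fock_scale (1 / of_nat n) (annihilation n f))"

text \<open>
  \<open>S\<^sub>k\<close>, the coefficient of \<open>z\<^bsup>-k\<^esup>\<close> in \<open>E_plus(z) E_minus(z\<^sup>-\<^sup>1)\<close>: the term \<open>z\<^sup>i z\<^bsup>-j\<^esup>\<close> contributes
  when \<open>j - i = k\<close>. As \<open>E_minus j f\<close> vanishes when \<open>j\<close> exceeds the degree of \<open>f\<close> (with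
  \<open>b\<^bsub>-n\<^esub>\<close> in degree \<open>n\<close>), the sum is finite.
\<close>

definition vertex_S :: "int \<Rightarrow> fock \<Rightarrow> fock" where
  "vertex_S k f = Sum_any (\<lambda>j. if int j \<ge> k then E_plus (nat (int j - k)) (E_minus j f) else 0)"

text \<open>The identification of \<open>b\<^bsub>-n\<^esub>\<close> with the power sum of degree \<open>n\<close>.\<close>

definition to_sym :: "fock \<Rightarrow> rat mfps" where
  "to_sym f = (\<Sum>m \<in> Poly_Mapping.keys f. mfps_const (Poly_Mapping.lookup f m) *
     (\<Prod>i \<in> Poly_Mapping.keys m. power_sum (i + 1) ^ Poly_Mapping.lookup m i))"

definition schur :: "int list \<Rightarrow> rat mfps" where
  "schur \<nu> = to_sym (foldr (\<lambda>a f. vertex_S (- a) f) \<nu> 1)"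


section \<open>Partitions and matrices\<close>

text \<open>The length of a partition is its number of (positive) parts.\<close>

definition partitions :: "int list set" where
  "partitions = {lam. sorted_wrt (\<ge>) lam \<and> (\<forall>a \<in> set lam. a > 0)}"

definition tuples :: "nat \<Rightarrow> nat list set" where
  "tuples l = {M. length M = l}"

text \<open>
  The number of nonnegative integer matrices with row sums \<open>M\<close> and column sums \<open>N\<close>; indices
  start from 0, and there are finitely many such matrices.
\<close>

definition matrix_count :: "nat list \<Rightarrow> nat list \<Rightarrow> nat" where
  "matrix_count M N = card {k \<in> ({..<length M} \<times> {..<length N}) \<rightarrow>\<^sub>E (UNIV :: nat set).
     map (\<lambda>i. \<Sum>j<length N. k (i, j)) [0..<length M] = M \<and>
     map (\<lambda>j. \<Sum>i<length M. k (i, j)) [0..<length N] = N}"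

definition shifted :: "int list \<Rightarrow> int list \<Rightarrow> nat list \<Rightarrow> nat list \<Rightarrow> int list" where
  "shifted lam \<mu> M N = map2 (\<lambda>a k. a + int k) lam M @ map2 (\<lambda>a k. a - int k) \<mu> N"


section \<open>The integers acting on series\<close>

definition int_scale :: "int \<Rightarrow> rat mfps \<Rightarrow> rat mfps" where
  "int_scale c f = of_int c * f"

interpretation int_mod: module int_scale
  by standard (simp_all add: int_scale_def algebra_simps)

end

(*
  Write D(t) and G(t) for the ring endomorphisms p_n -> p_n - t^n and p_n -> p_n + t^n of the Fock
  space, so that G(t) D(t) = 1 and E_minus(t) = D(t). Moving a factor g through E_minus in
  S(z) = E_plus(z) E_minus(1/z) gives (S_{-a} f) g = sum_k S_{-a-k} (f G_k g), and G(t) h_a =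
  sum_i h_{a-i} t^i gives G_k S_{-b} = sum_i S_{-b+i} G_{k-i}. Hence G_k s_mu is the sum of
  s_{mu-N} over all N of size k, and the product formula follows by induction on the length of
  lambda, the rows of the matrix (k_ij) being removed one at a time.

  For the basis property, G(t) also describes how a symmetric function depends on its first
  variable. The product rule above with f = 1 shows G_k s_lambda = 0 for k > lambda_1, and
  G_k s_lambda = s_(lambda_2, lambda_3, ...) for k = lambda_1. So the coefficient of x^lambda in
  s_lambda is 1, and those of x^mu with mu lexicographically larger than lambda vanish.
*)

theory Submission
  imports Defs "HOL-Computational_Algebra.Formal_Power_Series" "HOL-Library.List_Lexorder"
begin

section \<open>The Fock space\<close>

text \<open>The exponentials are given as sums of powers of operators, so even the multiplicativity
  of D(t) and G(t) has to be proved. With d_i the derivative by \<open>b_{-i}\<close>, the series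
  F(t) = G(t) f satisfies t F'(t) = (sum_i i t^i d_i) F(t), and D(t) f satisfies the same with a
  sign. Over the rationals such an equation determines F from F(0). Products, composites and images
  under commuting operators solve equations of this kind again, which yields the identities. The
  analogous equation for E_plus is Newton's recurrence for h_n.

  Infinite sums are cut off by the grading with \<open>b_{-n}\<close> in degree n, since G_k and D_k
  lower the degree by k. The same grading bounds N in the product formula: s_nu has degree the sum
  of nu, so it vanishes if this is negative.

  Integrality cannot be seen in the power sums, where h_n has denominators. It is read off from
  monomial coefficients, obtained by stripping off one variable after another through G. D_n
  preserves it because G(t) has constant term 1 and is therefore inverted without division.\<close>

abbreviation fock_const :: "rat \<Rightarrow> fock" where
  "fock_const c \<equiv> Poly_Mapping.single 0 c"

abbreviation fock_var :: "nat \<Rightarrow> fock" where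
  "fock_var i \<equiv> Poly_Mapping.single (Poly_Mapping.single i (Suc 0)) 1"

lemma poly_mapping_eq_sum_single:
  "f = (\<Sum>m \<in> Poly_Mapping.keys f. Poly_Mapping.single m (Poly_Mapping.lookup f m))"
  by (rule poly_mapping_eqI)
    (simp add: lookup_sum lookup_single when_def in_keys_iff sum.delta [OF finite_keys])

lemma poly_mapping_single_induct [case_names single add]:
  fixes f :: "'a \<Rightarrow>\<^sub>0 'b :: comm_monoid_add"
  assumes single: "\<And>m c. P (Poly_Mapping.single m c)"
    and add: "\<And>f g. P f \<Longrightarrow> P g \<Longrightarrow> P (f + g)"
  shows "P f"
proof -
  \<comment> \<open>For the empty sum, \<open>P 0\<close> is the assumption \<open>single\<close>
    with coefficient 0.\<close>
  have "P (\<Sum>m \<in> A. Poly_Mapping.single m (Poly_Mapping.lookup f m))" for A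
    by (induction A rule: infinite_finite_induct)
      (auto intro: add single simp: single [of undefined 0, simplified])
  then show ?thesis
    by (subst poly_mapping_eq_sum_single)
qed

lemma fock_single_eq_prod:
  "Poly_Mapping.single m c =
    fock_const c * (\<Prod>i \<in> Poly_Mapping.keys m. fock_var i ^ Poly_Mapping.lookup m i)"
proof -
  have pow: "fock_var i ^ k = Poly_Mapping.single (Poly_Mapping.single i k) 1" for i k
    by (induction k) (simp_all add: mult_single single_add [symmetric] single_one)
  have "(\<Prod>i \<in> A. fock_var i ^ Poly_Mapping.lookup m i) =
      Poly_Mapping.single (\<Sum>i \<in> A. Poly_Mapping.single i (Poly_Mapping.lookup m i)) 1" for A
    by (induction A rule: infinite_finite_induct)
      (simp_all add: pow mult_single single_one)
  then show ?thesis
    by (simp add: mult_single poly_mapping_eq_sum_single [symmetric])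
qed

text \<open>Reduces statements about derivations and ring homomorphisms on the Fock space to
  constants and variables.\<close>

lemma fock_ring_induct [case_names const var add mult]:
  assumes "\<And>c. P (fock_const c)" "\<And>i. P (fock_var i)"
    and "\<And>f g. P f \<Longrightarrow> P g \<Longrightarrow> P (f + g)" and mult: "\<And>f g. P f \<Longrightarrow> P g \<Longrightarrow> P (f * g)"
  shows "P f"
proof (induction f rule: poly_mapping_single_induct)
  case (single m c)
  have one: "P 1"
    using assms(1) [of 1] by simp
  have pow: "P (fock_var i ^ k)" for i k
    by (induction k) (simp_all only: power_0 power_Suc one mult assms(2))
  have "P (\<Prod>i \<in> A. fock_var i ^ Poly_Mapping.lookup m i)" for A
    by (induction A rule: infinite_finite_induct) (auto intro: one mult pow)
  then show ?case
    by (subst fock_single_eq_prod) (intro mult assms(1))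
qed (use assms in auto)

lemma fock_const_simps:
  "fock_const c * fock_const d = fock_const (c * d)"
  "fock_const c * (fock_const d * f) = fock_const (c * d) * f"
  "fock_const 1 = 1"
  by (simp_all add: mult_single mult.assoc [symmetric])

lemma of_nat_eq_fock_const: "(of_nat n :: fock) = fock_const (of_nat n)"
  by simp

text \<open>Division by positive integers is why a recurrence for \<open>n * F n\<close> determines
  \<open>F n\<close> when \<open>n > 0\<close>.\<close>

lemma of_nat_mult_fock_cancel:
  fixes f g :: fock
  assumes "n > 0" "of_nat n * f = of_nat n * g"
  shows "f = g"
proof -
  have "fock_const (1 / of_nat n) * (of_nat n * h) = h" for h
    using assms(1) by (simp only: of_nat_eq_fock_const fock_const_simps) simp
  then show ?thesis
    using assms(2) by metis
qed

text \<open>The support of a sum may be smaller than the union of the supports, so additivity is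
  proved over a common finite superset. \<open>weight_superset\<close> and
  \<open>to_sym_superset\<close> serve the same purpose.\<close>

lemma pderivative_superset:
  assumes "finite A" "Poly_Mapping.keys f \<subseteq> A"
  shows "pderivative i f = (\<Sum>m \<in> A. Poly_Mapping.single (m - Poly_Mapping.single i (Suc 0))
    (of_nat (Poly_Mapping.lookup m i) * Poly_Mapping.lookup f m))"
  unfolding pderivative_def One_nat_def
  by (rule sum.mono_neutral_left) (use assms in \<open>auto simp: in_keys_iff\<close>)

lemma pderivative_single:
  "pderivative i (Poly_Mapping.single m c) =
    Poly_Mapping.single (m - Poly_Mapping.single i (Suc 0)) (of_nat (Poly_Mapping.lookup m i) * c)"
  by (subst pderivative_superset [where A = "{m}"]) (auto)

lemma pderivative_add: "pderivative i (f + g) = pderivative i f + pderivative i g"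
proof -
  let ?A = "Poly_Mapping.keys f \<union> Poly_Mapping.keys g"
  have "Poly_Mapping.keys (f + g) \<subseteq> ?A"
    by (rule keys_add)
  then show ?thesis
    by (simp add: pderivative_superset [of ?A] lookup_add distrib_left single_add sum.distrib)
qed

lemma pderivative_mult:
  "pderivative i (f * g) = pderivative i f * g + f * pderivative i g"
proof -
  \<comment> \<open>Subtraction of exponents is truncated, hence the condition that \<open>i\<close>
    occurs in \<open>m\<close>; otherwise the derivative has coefficient 0 anyway.\<close>
  have shift: "m - Poly_Mapping.single i (Suc 0) + m' = m + m' - Poly_Mapping.single i (Suc 0)"
    if "Poly_Mapping.lookup m i > 0" for m m' :: "nat \<Rightarrow>\<^sub>0 nat"
    using that by (intro poly_mapping_eqI)
      (auto simp: lookup_add lookup_minus lookup_single when_def)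
  have monomials: "pderivative i (Poly_Mapping.single m c * Poly_Mapping.single m' d) =
      pderivative i (Poly_Mapping.single m c) * Poly_Mapping.single m' d +
      Poly_Mapping.single m c * pderivative i (Poly_Mapping.single m' d)" for m m' c d
  proof -
    have "pderivative i (Poly_Mapping.single m c) * Poly_Mapping.single m' d =
        Poly_Mapping.single (m + m' - Poly_Mapping.single i (Suc 0))
          (of_nat (Poly_Mapping.lookup m i) * (c * d))" for m m' c d
      by (cases "Poly_Mapping.lookup m i = 0")
        (simp_all add: pderivative_single mult_single shift mult.assoc)
    from this [of m c m' d] this [of m' d m c] show ?thesis
      by (simp add: pderivative_single mult_single lookup_add single_add [symmetric]
          algebra_simps)
  qed
  have "pderivative i (Poly_Mapping.single m c * g) =
      pderivative i (Poly_Mapping.single m c) * g + Poly_Mapping.single m c * pderivative i g" for m c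
    by (induction g rule: poly_mapping_single_induct)
      (simp_all add: monomials distrib_left pderivative_add)
  then show ?thesis
    by (induction f rule: poly_mapping_single_induct)
      (simp_all add: distrib_right pderivative_add)
qed

lemma pderivative_const [simp]: "pderivative i (fock_const c) = 0"
  by (simp add: pderivative_single)

lemma pderivative_simps [simp]:
  "pderivative i 0 = 0" "pderivative i 1 = 0" "pderivative i (of_nat n) = 0"
  using pderivative_const [of i 0] pderivative_const [of i 1] pderivative_const [of i "of_nat n"]
  by (simp_all del: pderivative_const)

lemma pderivative_var: "pderivative i (fock_var j) = (if i = j then 1 else 0)"
  by (auto simp: pderivative_single lookup_single)

lemma pderivative_const_mult: "pderivative i (fock_const c * f) = fock_const c * pderivative i f"
  by (simp add: pderivative_mult)

lemma pderivative_of_nat_mult: "pderivative i (of_nat n * f) = of_nat n * pderivative i f"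
  by (simp add: pderivative_mult)

lemma pderivative_sum: "pderivative i (sum f A) = (\<Sum>x \<in> A. pderivative i (f x))"
  by (induction A rule: infinite_finite_induct) (simp_all add: pderivative_add)

lemma pderivative_commute: "pderivative i (pderivative j f) = pderivative j (pderivative i f)"
  by (induction f rule: fock_ring_induct)
    (simp_all add: pderivative_var pderivative_add pderivative_mult del: One_nat_def)


section \<open>Exponentials of commuting operators\<close>

text \<open>An \<open>op_series\<close> consists of bare functions, so linearity over the rationals
  is carried as a property. It lets an operator pass through the finite sums in
  \<open>op_mult\<close>.\<close>

definition fock_linear :: "(fock \<Rightarrow> fock) \<Rightarrow> bool" where
  "fock_linear A \<longleftrightarrow> (\<forall>f g. A (f + g) = A f + A g) \<and>
    (\<forall>c f. A (fock_const c * f) = fock_const c * A f)"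

lemma fock_linear_add: "fock_linear A \<Longrightarrow> A (f + g) = A f + A g"
  and fock_linear_const_mult: "fock_linear A \<Longrightarrow> A (fock_const c * f) = fock_const c * A f"
  by (simp_all add: fock_linear_def)

lemma fock_linear_0: "fock_linear A \<Longrightarrow> A 0 = 0"
  using fock_linear_const_mult [of A 0 0] by simp

lemma fock_linear_of_nat_mult: "fock_linear A \<Longrightarrow> A (of_nat n * f) = of_nat n * A f"
  using fock_linear_const_mult [of A "of_nat n" f] by simp

lemma fock_linear_sum:
  "fock_linear A \<Longrightarrow> A (sum f X) = (\<Sum>x \<in> X. A (f x))"
  by (induction X rule: infinite_finite_induct) (simp_all add: fock_linear_0 fock_linear_add)

lemma fock_linear_id: "fock_linear (\<lambda>f. f)"
  by (simp add: fock_linear_def)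

lemma fock_linear_zero: "fock_linear (\<lambda>f. 0)"
  by (simp add: fock_linear_def)

lemma fock_linear_mult: "fock_linear (\<lambda>f. g * f)"
  by (simp add: fock_linear_def distrib_left mult.left_commute)

lemma fock_linear_pderivative: "fock_linear (pderivative i)"
  by (simp add: fock_linear_def pderivative_add pderivative_const_mult)

lemma fock_linear_comp:
  "fock_linear A \<Longrightarrow> fock_linear B \<Longrightarrow> fock_linear (\<lambda>f. A (B f))"
  by (simp add: fock_linear_def)

lemma fock_linear_sum_ops:
  "(\<And>x. x \<in> X \<Longrightarrow> fock_linear (A x)) \<Longrightarrow> fock_linear (\<lambda>f. \<Sum>x \<in> X. A x f)"
  by (simp add: fock_linear_def sum.distrib sum_distrib_left)

text \<open>The coefficientwise form of \<open>t (A\<^sup>k)' = k (t A') A\<^sup>k\<^sup>-\<^sup>1\<close>.\<close>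

lemma op_mult_power_derivative:
  assumes lin: "\<And>i. fock_linear (A i)" and comm: "\<And>i j f. A i (A j f) = A j (A i f)"
  shows "of_nat n * (op_mult A ^^ Suc k) op_one n f =
    of_nat (Suc k) * (\<Sum>i\<le>n. of_nat i * A i ((op_mult A ^^ k) op_one (n - i) f))"
proof (induction k arbitrary: n)
  case 0
  have one: "A i (op_one (n - i) f) = (if i = n then A n f else 0)" if "i \<le> n" for i n
    using that by (auto simp: op_one_def fock_linear_0 [OF lin])
  have "op_mult A op_one n f = A n f"
    by (simp add: op_mult_def one)
  moreover have "(\<Sum>i\<le>n. of_nat i * A i (op_one (n - i) f)) = of_nat n * A n f"
    by (simp add: one if_distrib cong: if_cong)
  ultimately show ?case
    by simp
next
  case (Suc k)
  define P where "P k n = (op_mult A ^^ k) op_one n f" for k n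
  have P_Suc: "P (Suc k) n = (\<Sum>i\<le>n. A i (P k (n - i)))" for k n
    by (simp add: P_def op_mult_def)
  have IH: "of_nat n * P (Suc k) n = of_nat (Suc k) * (\<Sum>i\<le>n. of_nat i * A i (P k (n - i)))" for n
    unfolding P_def by (rule Suc.IH)
  have "of_nat n * P (Suc (Suc k)) n = (\<Sum>i\<le>n. of_nat n * A i (P (Suc k) (n - i)))"
    by (simp add: P_Suc [of "Suc k"] sum_distrib_left)
  \<comment> \<open>Writing \<open>n = i + (n - i)\<close> is the Leibniz rule for the product of
    \<open>A\<close> with its power.\<close>
  also have "\<dots> = (\<Sum>i\<le>n. of_nat i * A i (P (Suc k) (n - i)) + A i (of_nat (n - i) * P (Suc k) (n - i)))"
    by (rule sum.cong)
      (simp_all add: fock_linear_of_nat_mult [OF lin] distrib_right [symmetric]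
        of_nat_add [symmetric] del: of_nat_diff)
  also have "\<dots> = (\<Sum>i\<le>n. of_nat i * A i (P (Suc k) (n - i))) + (\<Sum>i\<le>n. A i (of_nat (n - i) * P (Suc k) (n - i)))"
    by (rule sum.distrib)
  also have "(\<Sum>i\<le>n. A i (of_nat (n - i) * P (Suc k) (n - i))) =
      of_nat (Suc k) * (\<Sum>i\<le>n. \<Sum>j\<le>n - i. of_nat j * A j (A i (P k (n - i - j))))"
    by (simp only: IH fock_linear_of_nat_mult [OF lin] fock_linear_sum [OF lin] sum_distrib_left comm)
  \<comment> \<open>Renaming \<open>i\<close> and \<open>j\<close> identifies the second part with
    \<open>k + 1\<close> copies of the first.\<close>
  also have "(\<Sum>i\<le>n. \<Sum>j\<le>n - i. of_nat j * A j (A i (P k (n - i - j)))) =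
      (\<Sum>i\<le>n. \<Sum>j\<le>n - i. of_nat i * A i (A j (P k (n - i - j))))"
    unfolding sum.Sigma [OF finite_atMost ballI [OF finite_atMost]]
    by (rule sum.reindex_bij_witness [where i = prod.swap and j = prod.swap])
      (auto simp: add.commute)
  also have "\<dots> = (\<Sum>i\<le>n. of_nat i * A i (P (Suc k) (n - i)))"
    by (simp only: P_Suc fock_linear_sum [OF lin] sum_distrib_left)
  finally have "of_nat n * P (Suc (Suc k)) n =
      of_nat (Suc (Suc k)) * (\<Sum>i\<le>n. of_nat i * A i (P (Suc k) (n - i)))"
    by (simp add: distrib_right)
  then show ?case
    unfolding P_def .
qed

text \<open>Allows the cut-off \<open>k <= n\<close> in \<open>op_exp\<close> to be raised, so that
  different coefficients can share one bound.\<close>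

lemma op_mult_power_eq_0:
  assumes lin: "\<And>i. fock_linear (A i)" and A0: "\<And>f. A 0 f = 0" and "n < k"
  shows "(op_mult A ^^ k) op_one n f = 0"
  using \<open>n < k\<close>
proof (induction k arbitrary: n)
  case (Suc k)
  have "A i ((op_mult A ^^ k) op_one (n - i) f) = 0" if "i \<le> n" for i
    using Suc that by (cases "i = 0") (simp_all add: A0 fock_linear_0 [OF lin])
  moreover have "(op_mult A ^^ Suc k) op_one n f = (\<Sum>i\<le>n. A i ((op_mult A ^^ k) op_one (n - i) f))"
    by (simp add: op_mult_def)
  ultimately show ?case
    by simp
qed simp

lemma fock_linear_op_mult_power:
  assumes lin: "\<And>i. fock_linear (A i)"
  shows "fock_linear ((op_mult A ^^ k) op_one n)"
proof (induction k arbitrary: n)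
  case 0
  then show ?case
    by (cases "n = 0") (simp_all add: op_one_def [abs_def] fock_linear_id fock_linear_zero)
next
  case (Suc k)
  have "(op_mult A ^^ Suc k) op_one n = (\<lambda>f. \<Sum>i\<le>n. A i ((op_mult A ^^ k) op_one (n - i) f))"
    by (simp add: op_mult_def fun_eq_iff)
  then show ?case
    by (simp only:) (rule fock_linear_sum_ops, rule fock_linear_comp [OF lin Suc])
qed

lemma fock_linear_op_exp:
  assumes lin: "\<And>i. fock_linear (A i)"
  shows "fock_linear (op_exp A n)"
proof -
  have "fock_linear (\<lambda>f. \<Sum>k\<le>n. fock_const (1 / fact k) * (op_mult A ^^ k) op_one n f)"
    by (rule fock_linear_sum_ops, rule fock_linear_comp [OF fock_linear_mult fock_linear_op_mult_power],
        rule lin)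
  then show ?thesis
    by (simp add: op_exp_def [abs_def] fock_scale_def)
qed

lemma op_exp_0: "op_exp A 0 f = f"
  by (simp add: op_exp_def op_one_def fock_scale_def fock_const_simps)

text \<open>The coefficients of \<open>t (exp A)' = (t A') exp A\<close>, from
  \<open>op_mult_power_derivative\<close> and \<open>k / k! = 1 / (k - 1)!\<close>.\<close>

lemma op_exp_derivative:
  assumes lin: "\<And>i. fock_linear (A i)" and comm: "\<And>i j f. A i (A j f) = A j (A i f)"
    and A0: "\<And>f. A 0 f = 0"
  shows "of_nat n * op_exp A n f = (\<Sum>i\<le>n. of_nat i * A i (op_exp A (n - i) f))"
proof -
  define P where "P k n = (op_mult A ^^ k) op_one n f" for k n
  define c where "c k = fock_const (1 / fact k)" for k
  have exp: "op_exp A n f = (\<Sum>k\<le>N. c k * P k n)" if "n \<le> N" for n N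
    unfolding op_exp_def fock_scale_def P_def [symmetric] c_def [symmetric]
    by (rule sum.mono_neutral_left)
      (use that in \<open>auto simp: P_def op_mult_power_eq_0 [where A = A, OF lin A0]\<close>)
  have c_Suc: "c (Suc k) * of_nat (Suc k) = c k" for k
  proof -
    have "1 / fact (Suc k) * of_nat (Suc k) = (1 / fact k :: rat)"
      by (simp add: fact_Suc del: of_nat_Suc)
    then show ?thesis
      by (simp only: c_def of_nat_eq_fock_const fock_const_simps)
  qed
  \<comment> \<open>With the bound \<open>Suc n\<close>, dropping the vanishing term
    \<open>k = 0\<close> and shifting leaves exactly \<open>k <= n\<close>.\<close>
  have "of_nat n * op_exp A n f = (\<Sum>k\<le>Suc n. c k * (of_nat n * P k n))"
    by (subst exp [of n "Suc n"]) (simp_all add: sum_distrib_left mult.left_commute distrib_left)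
  also have "\<dots> = (\<Sum>k\<le>n. c (Suc k) * (of_nat n * P (Suc k) n))"
    by (subst sum.atMost_Suc_shift) (simp add: P_def op_one_def)
  also have "\<dots> = (\<Sum>k\<le>n. c k * (\<Sum>i\<le>n. of_nat i * A i (P k (n - i))))"
    unfolding P_def op_mult_power_derivative [where A = A, OF lin comm]
    by (simp only: mult.assoc [symmetric] c_Suc)
  also have "\<dots> = (\<Sum>i\<le>n. \<Sum>k\<le>n. c k * (of_nat i * A i (P k (n - i))))"
    by (simp only: sum_distrib_left) (rule sum.swap)
  also have "\<dots> = (\<Sum>i\<le>n. of_nat i * A i (op_exp A (n - i) f))"
    by (simp only: exp [of "n - _" n, OF diff_le_self] fock_linear_sum [OF lin] sum_distrib_left
        fock_linear_const_mult [OF lin] c_def mult.left_commute)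
  finally show ?thesis .
qed


unbundle fps_syntax

section \<open>Translations of the power sums\<close>

text \<open>\<open>\<Sum>n. translate c n t\<^sup>n\<close> is the ring homomorphism \<open>p\<^sub>n \<mapsto> p\<^sub>n + c t\<^sup>n\<close>.\<close>

definition translate :: "rat \<Rightarrow> op_series" where
  "translate c = op_exp (\<lambda>n f. if n = 0 then 0 else fock_const c * pderivative (n - 1) f)"

lemma fock_linear_translate_exponent:
  "fock_linear (\<lambda>f. if n = 0 then 0 else fock_const c * pderivative (n - 1) f)"
  by (cases "n = 0")
    (simp_all add: fock_linear_zero fock_linear_comp [OF fock_linear_mult fock_linear_pderivative])

lemma fock_linear_translate: "fock_linear (translate c n)"
  unfolding translate_def
  by (rule fock_linear_op_exp) (rule fock_linear_translate_exponent)

lemmas translate_add = fock_linear_add [OF fock_linear_translate]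
  and translate_sum = fock_linear_sum [OF fock_linear_translate]
  and translate_zero [simp] = fock_linear_0 [OF fock_linear_translate]
  and translate_const_mult = fock_linear_const_mult [OF fock_linear_translate]
  and translate_of_nat_mult = fock_linear_of_nat_mult [OF fock_linear_translate]

text \<open>The factor \<open>n\<close> in \<open>annihilation\<close> cancels the
  \<open>1/n\<close> of the exponent.\<close>

lemma E_minus_eq_translate: "E_minus = translate (- 1)"
proof -
  have "(if n = 0 then 0 else - fock_scale (1 / of_nat n) (annihilation n f)) =
      (if n = 0 then 0 else fock_const (- 1) * pderivative (n - 1) f)" for n and f :: fock
  proof (cases "n = 0")
    case False
    have "fock_const (1 / of_nat n) * (of_nat n * g) = g" for g
      using False by (simp only: of_nat_eq_fock_const fock_const_simps) simp
    with False show ?thesis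
      by (simp add: fock_scale_def annihilation_def single_uminus)
  qed simp
  then show ?thesis
    by (simp add: E_minus_def translate_def)
qed

lemma translate_0 [simp]: "translate c 0 f = f"
  by (simp add: translate_def op_exp_0)

text \<open>The differential equation of the translation, with \<open>pderivative (i - 1)\<close>
  the derivative by \<open>b_{-i}\<close>. At \<open>i = 0\<close>, where \<open>i - 1\<close> is
  truncated, the factor is 0.\<close>

lemma translate_derivative:
  "of_nat n * translate c n f =
    fock_const c * (\<Sum>i\<le>n. of_nat i * pderivative (i - 1) (translate c (n - i) f))"
proof -
  let ?A = "\<lambda>n f. if n = 0 then 0 else fock_const c * pderivative (n - 1) f"
  have comm: "?A i (?A j f) = ?A j (?A i f)" for i j f
    by (simp add: pderivative_const_mult)
      (metis pderivative_commute)
  have "of_nat n * translate c n f = (\<Sum>i\<le>n. of_nat i * ?A i (translate c (n - i) f))"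
    unfolding translate_def
    by (rule op_exp_derivative [where A = ?A, OF fock_linear_translate_exponent comm]) simp
  moreover have "of_nat i * ?A i g = fock_const c * (of_nat i * pderivative (i - 1) g)" for i g
    by (cases "i = 0") (simp_all add: mult.left_commute)
  ultimately show ?thesis
    by (simp only: sum_distrib_left)
qed

text \<open>The terms with \<open>i > 0\<close> involve earlier coefficients only, so a solution is
  fixed by its constant term. Most identities for \<open>translate\<close> are obtained by
  exhibiting another solution.\<close>

lemma translate_unique:
  assumes "\<And>n. of_nat n * F n = fock_const c * (\<Sum>i\<le>n. of_nat i * pderivative (i - 1) (F (n - i)))"
  shows "F n = translate c n (F 0)"
proof (induction n rule: less_induct)
  case (less n)
  show ?case
  proof (cases "n = 0")
    case False
    have "of_nat i * pderivative (i - 1) (F (n - i)) =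
        of_nat i * pderivative (i - 1) (translate c (n - i) (F 0))" for i
      using less [of "n - i"] False by (cases "i = 0") simp_all
    then have "of_nat n * F n = of_nat n * translate c n (F 0)"
      by (simp only: assms translate_derivative)
    then show ?thesis
      using False of_nat_mult_fock_cancel by blast
  qed simp
qed

text \<open>The derivation \<open>sum_i i t^i d_i\<close>, with \<open>d_i\<close> the derivative by
  \<open>b_{-i}\<close>. On the type \<open>fps\<close>, products of series are available as ring
  multiplication.\<close>

definition fps_pderivative :: "fock fps \<Rightarrow> fock fps" where
  "fps_pderivative F = Abs_fps (\<lambda>n. \<Sum>i\<le>n. of_nat i * pderivative (i - 1) (F $ (n - i)))"

lemma fps_pderivative_mult:
  "fps_pderivative (F * G) = fps_pderivative F * G + F * fps_pderivative G"
proof (rule fps_ext)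
  fix n
  let ?d = "\<lambda>i f. of_nat i * pderivative (i - 1) f"
  have d_mult: "?d i (f * g) = ?d i f * g + f * ?d i g" for i f g
    by (simp add: pderivative_mult algebra_simps)
  have d_sum: "?d i (sum f A) = (\<Sum>x \<in> A. ?d i (f x))" for i and f :: "nat \<Rightarrow> fock" and A
    by (simp add: pderivative_sum sum_distrib_left)
  have "fps_pderivative (F * G) $ n =
      (\<Sum>i=0..n. \<Sum>j=0..n - i. ?d i (F $ j) * G $ (n - i - j)) +
      (\<Sum>i=0..n. \<Sum>j=0..n - i. F $ j * ?d i (G $ (n - i - j)))"
    by (simp only: fps_pderivative_def fps_nth_Abs_fps fps_mult_nth d_sum d_mult sum.distrib
        atMost_atLeast0)
  also have "(\<Sum>i=0..n. \<Sum>j=0..n - i. ?d i (F $ j) * G $ (n - i - j)) = (fps_pderivative F * G) $ n"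
    by (simp only: fps_mult_assoc_lemma [of "\<lambda>i j k. ?d i (F $ j) * G $ k", symmetric]
        fps_pderivative_def fps_nth_Abs_fps fps_mult_nth sum_distrib_right atMost_atLeast0)
  also have "(\<Sum>i=0..n. \<Sum>j=0..n - i. F $ j * ?d i (G $ (n - i - j))) =
      (\<Sum>j=0..n. \<Sum>i=0..n - j. F $ j * ?d i (G $ (n - j - i)))"
    unfolding sum.Sigma [OF finite_atLeastAtMost ballI [OF finite_atLeastAtMost]]
    by (rule sum.reindex_bij_witness [where i = prod.swap and j = prod.swap])
      (auto simp: add.commute)
  also have "\<dots> = (F * fps_pderivative G) $ n"
    by (simp only: fps_pderivative_def fps_nth_Abs_fps fps_mult_nth sum_distrib_left atMost_atLeast0)
  finally show "fps_pderivative (F * G) $ n = (fps_pderivative F * G + F * fps_pderivative G) $ n"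
    by simp
qed

text \<open>By the Leibniz rules for \<open>fps_XD\<close> and \<open>fps_pderivative\<close>, the
  product of the series of \<open>f\<close> and \<open>g\<close> solves the same equation, with
  constant term \<open>f * g\<close>.\<close>

lemma translate_mult:
  "translate c n (f * g) = (\<Sum>i\<le>n. translate c i f * translate c (n - i) g)"
proof -
  define T where "T f = Abs_fps (\<lambda>n. translate c n f)" for f
  have XD_mult: "fps_XD (F * G) = fps_XD F * G + F * fps_XD G" for F G :: "fock fps"
    by (simp add: fps_XD_def algebra_simps)
  have XD: "fps_XD (T f) = fps_const (fock_const c) * fps_pderivative (T f)" for f
    by (rule fps_ext) (simp add: fps_XD_nth T_def fps_pderivative_def translate_derivative)
  have *: "fps_XD (T f * T g) = fps_const (fock_const c) * fps_pderivative (T f * T g)"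
    by (simp add: XD_mult XD fps_pderivative_mult algebra_simps)
  have "of_nat n * (T f * T g) $ n =
      fock_const c * (\<Sum>i\<le>n. of_nat i * pderivative (i - 1) ((T f * T g) $ (n - i)))" for n
    using arg_cong [OF *, of "\<lambda>F. F $ n"] by (simp add: fps_XD_nth fps_pderivative_def)
  then have "(T f * T g) $ n = translate c n ((T f * T g) $ 0)"
    by (rule translate_unique)
  then show ?thesis
    by (simp add: fps_mult_nth T_def atMost_atLeast0)
qed

text \<open>A linear operator that commutes with all partial derivatives maps solutions to
  solutions. The next lemma applies this to \<open>translate d k\<close>.\<close>

lemma translate_pderivative: "translate c n (pderivative k f) = pderivative k (translate c n f)"
proof -
  have "of_nat n * pderivative k (translate c n f) = fock_const c *
      (\<Sum>i\<le>n. of_nat i * pderivative (i - 1) (pderivative k (translate c (n - i) f)))" for n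
    using arg_cong [OF translate_derivative [of n c f], of "pderivative k"]
    by (simp only: pderivative_of_nat_mult pderivative_const_mult pderivative_sum pderivative_commute)
  from translate_unique [of "\<lambda>n. pderivative k (translate c n f)", OF this]
  show ?thesis
    by simp
qed

lemma translate_commute: "translate c n (translate d k f) = translate d k (translate c n f)"
proof -
  have "of_nat n * translate d k (translate c n f) = fock_const c *
      (\<Sum>i\<le>n. of_nat i * pderivative (i - 1) (translate d k (translate c (n - i) f)))" for n
    using arg_cong [OF translate_derivative [of n c f], of "translate d k"]
    by (simp only: translate_of_nat_mult translate_const_mult translate_sum translate_pderivative)
  from translate_unique [of "\<lambda>n. translate d k (translate c n f)", OF this]
  show ?thesis
    by simp
qed

text \<open>The composite solves the equation with constant \<open>c + d\<close>: in
  \<open>n = i + (n - i)\<close> one summand differentiates the outer series, the other the inner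
  one.\<close>

lemma translate_translate:
  "(\<Sum>i\<le>n. translate c i (translate d (n - i) f)) = translate (c + d) n f"
proof -
  define F where "F n = translate d n f" for n
  define Q where "Q n = (\<Sum>i\<le>n. translate c i (F (n - i)))" for n
  let ?d = "\<lambda>i f. of_nat i * pderivative (i - 1) f"
  have "of_nat n * Q n = fock_const (c + d) * (\<Sum>i\<le>n. ?d i (Q (n - i)))" for n
  proof -
    have "of_nat n * Q n = (\<Sum>i\<le>n. of_nat i * translate c i (F (n - i))) +
        (\<Sum>i\<le>n. translate c i (of_nat (n - i) * F (n - i)))"
      by (simp add: Q_def sum_distrib_left sum.distrib [symmetric] translate_of_nat_mult
          distrib_right [symmetric] of_nat_add [symmetric] del: of_nat_diff)
    also have "(\<Sum>i\<le>n. of_nat i * translate c i (F (n - i))) =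
        fock_const c * (\<Sum>i=0..n. \<Sum>j=0..i. ?d j (translate c (i - j) (F (n - i))))"
      by (simp only: translate_derivative sum_distrib_left atMost_atLeast0)
    also have "\<dots> = fock_const c * (\<Sum>i=0..n. \<Sum>j=0..n - i. ?d i (translate c j (F (n - i - j))))"
      by (simp only: fps_mult_assoc_lemma [of "\<lambda>i j k. ?d i (translate c j (F k))"])
    also have "\<dots> = fock_const c * (\<Sum>i\<le>n. ?d i (Q (n - i)))"
      by (simp only: Q_def pderivative_sum sum_distrib_left atMost_atLeast0)
    also have "(\<Sum>i\<le>n. translate c i (of_nat (n - i) * F (n - i))) =
        fock_const d * (\<Sum>i\<le>n. \<Sum>j\<le>n - i. ?d j (translate c i (F (n - i - j))))"
      by (simp only: F_def translate_derivative [of _ d] translate_const_mult translate_sum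
          translate_of_nat_mult translate_pderivative sum_distrib_left)
    also have "(\<Sum>i\<le>n. \<Sum>j\<le>n - i. ?d j (translate c i (F (n - i - j)))) =
        (\<Sum>j\<le>n. \<Sum>i\<le>n - j. ?d j (translate c i (F (n - j - i))))"
      unfolding sum.Sigma [OF finite_atMost ballI [OF finite_atMost]]
      by (rule sum.reindex_bij_witness [where i = prod.swap and j = prod.swap])
        (auto simp: add.commute)
    also have "\<dots> = (\<Sum>i\<le>n. ?d i (Q (n - i)))"
      by (simp only: Q_def pderivative_sum sum_distrib_left)
    finally show ?thesis
      by (simp only: single_add distrib_right)
  qed
  from translate_unique [of Q, OF this, of n] show ?thesis
    by (simp add: Q_def F_def)
qed

lemma translate_const: "translate c n (fock_const a) = (if n = 0 then fock_const a else 0)"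
  using translate_unique [of "\<lambda>n. if n = 0 then fock_const a else 0" c n]
  by (auto simp: if_distrib cong: if_cong)

lemma translate_one: "translate c n 1 = (if n = 0 then 1 else 0)"
  using translate_const [of c n 1] by (simp add: fock_const_simps)

lemma translate_0_left: "translate 0 n f = (if n = 0 then f else 0)"
  using of_nat_mult_fock_cancel [of n "translate 0 n f" 0] translate_derivative [of n 0 f]
  by simp

lemma translate_inverse:
  "(\<Sum>i\<le>n. translate (- c) i (translate c (n - i) f)) = (if n = 0 then f else 0)"
  by (simp only: translate_translate) (simp add: translate_0_left)

lemma translate_var:
  "translate c n (fock_var i) = (if n = 0 then fock_var i else if n = Suc i then fock_const c else 0)"
proof -
  let ?F = "\<lambda>n. if n = 0 then fock_var i else if n = Suc i then fock_const c else 0"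
  have "of_nat n * ?F n = fock_const c * (\<Sum>j\<le>n. of_nat j * pderivative (j - 1) (?F (n - j)))" for n
  proof -
    \<comment> \<open>At \<open>j = 0\<close> the factor is 0, and for \<open>0 < j < n\<close> the
      entry \<open>?F (n - j)\<close> is constant, so only \<open>j = n\<close> remains.\<close>
    have "(\<Sum>j\<le>n. of_nat j * pderivative (j - 1) (?F (n - j))) =
        (\<Sum>j\<in>{n}. of_nat j * pderivative (j - 1) (?F (n - j)))"
      by (rule sum.mono_neutral_right) auto
    then show ?thesis
      by (auto simp: pderivative_var)
  qed
  from translate_unique [of ?F, OF this] show ?thesis
    by simp
qed


section \<open>Complete symmetric functions\<close>

text \<open>The complete symmetric function \<open>h_a\<close> written in the power sums. Integer
  indices with value 0 below 0 make index shifts valid without case distinctions.\<close>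

definition fock_complete :: "int \<Rightarrow> fock" where
  "fock_complete a = (if a \<ge> 0 then E_plus (nat a) 1 else 0)"

lemma fock_complete_simps [simp]: "fock_complete 0 = 1" "a < 0 \<Longrightarrow> fock_complete a = 0"
  by (simp_all add: fock_complete_def E_plus_def op_exp_0)

text \<open>The differential equation for an exponential of multiplication operators. For
  \<open>f = 1\<close> it is Newton's recurrence \<open>n h_n = sum_i p_i h_(n-i)\<close>.\<close>

lemma E_plus_derivative:
  "of_nat n * E_plus n f = (\<Sum>i=1..n. fock_var (i - 1) * E_plus (n - i) f)"
proof -
  let ?A = "\<lambda>n f. if n = 0 then 0 else fock_scale (1 / of_nat n) (creation n f)"
  have lin: "fock_linear (?A n)" for n
  proof (cases "n = 0")
    case False
    then show ?thesis
      using fock_linear_comp [OF fock_linear_mult fock_linear_mult]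
      by (simp add: fock_scale_def creation_def)
  qed (simp add: fock_linear_zero)
  have comm: "?A i (?A j f) = ?A j (?A i f)" for i j f
    by (simp add: fock_scale_def creation_def mult.left_commute mult.assoc)
  have "of_nat n * E_plus n f = (\<Sum>i\<le>n. of_nat i * ?A i (E_plus (n - i) f))"
    unfolding E_plus_def
    by (rule op_exp_derivative [where A = ?A, OF lin comm]) simp
  also have "\<dots> = (\<Sum>i=1..n. of_nat i * ?A i (E_plus (n - i) f))"
    by (rule sum.mono_neutral_right) auto
  also have "\<dots> = (\<Sum>i=1..n. fock_var (i - 1) * E_plus (n - i) f)"
  proof (rule sum.cong)
    fix i assume "i \<in> {1..n}"
    then have "of_nat i * (fock_const (1 / of_nat i) * g) = g" for g
      by (simp only: of_nat_eq_fock_const fock_const_simps) (simp add: fock_const_simps)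
    with \<open>i \<in> {1..n}\<close> show "of_nat i * ?A i (E_plus (n - i) f) = fock_var (i - 1) * E_plus (n - i) f"
      by (simp add: fock_scale_def creation_def)
  qed simp
  finally show ?thesis .
qed

text \<open>Both sides satisfy the recurrence of \<open>E_plus_derivative\<close>.\<close>

lemma E_plus_eq_fock_complete: "E_plus n f = fock_complete (int n) * f"
proof (induction n rule: less_induct)
  case (less n)
  show ?case
  proof (cases "n = 0")
    case False
    have "of_nat n * E_plus n f = of_nat n * (E_plus n 1 * f)"
      unfolding mult.assoc [symmetric] E_plus_derivative sum_distrib_right
      by (rule sum.cong) (use less in \<open>auto simp: fock_complete_def mult.assoc\<close>)
    with False show ?thesis
      by (simp add: fock_complete_def of_nat_mult_fock_cancel)
  qed (simp add: E_plus_def op_exp_0)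
qed

lemma fock_complete_newton:
  "of_nat n * fock_complete (int n) = (\<Sum>i=1..n. fock_var (i - 1) * fock_complete (int (n - i)))"
  using E_plus_derivative [of n 1] by (simp add: fock_complete_def del: of_nat_diff)

text \<open>With \<open>r = k + 1\<close>, differentiating
  \<open>sum_a h_a z^a = exp (sum_r p_r z^r / r)\<close> by \<open>p_r\<close> multiplies it by
  \<open>z^r / r\<close>. The proof differentiates Newton's recurrence instead.\<close>

lemma pderivative_fock_complete:
  "of_nat (Suc k) * pderivative k (fock_complete a) = fock_complete (a - int (Suc k))"
proof -
  have "of_nat (Suc k) * pderivative k (fock_complete (int n)) = fock_complete (int n - int (Suc k))" for n
  proof (induction n rule: less_induct)
    case (less n)
    show ?case
    proof (cases "n = 0")
      case False
      have "of_nat n * (of_nat (Suc k) * pderivative k (fock_complete (int n))) =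
          of_nat (Suc k) * pderivative k (\<Sum>i=1..n. fock_var (i - 1) * fock_complete (int (n - i)))"
        unfolding fock_complete_newton [symmetric] by (simp only: pderivative_of_nat_mult mult.left_commute)
      also have "\<dots> = (\<Sum>i=1..n. (if i = Suc k then of_nat (Suc k) * fock_complete (int n - int (Suc k)) else 0)
          + fock_var (i - 1) * (of_nat (Suc k) * pderivative k (fock_complete (int (n - i)))))"
        unfolding pderivative_sum sum_distrib_left
        by (rule sum.cong)
          (auto simp: pderivative_mult pderivative_var distrib_left of_nat_diff
            simp del: of_nat_Suc intro!: mult.left_commute)
      also have "\<dots> = (if Suc k \<le> n then of_nat (Suc k) * fock_complete (int n - int (Suc k)) else 0) +
          (\<Sum>i=1..n. fock_var (i - 1) * fock_complete (int (n - i) - int (Suc k)))"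
        unfolding sum.distrib
        by (intro arg_cong2 [where f = "(+)"] sum.cong refl, simp, subst less.IH, auto)
      also have "\<dots> = of_nat n * fock_complete (int n - int (Suc k))"
      \<comment> \<open>The two parts contribute \<open>k + 1\<close> and \<open>n - (k + 1)\<close>
        copies. If \<open>n <= k\<close>, every complete function involved has negative
        index.\<close>
      proof (cases "Suc k \<le> n")
        case True
        have "(\<Sum>i=1..n. fock_var (i - 1) * fock_complete (int (n - i) - int (Suc k))) =
            (\<Sum>i=1..n - Suc k. fock_var (i - 1) * fock_complete (int (n - i) - int (Suc k)))"
          by (rule sum.mono_neutral_right) auto
        also have "\<dots> = of_nat (n - Suc k) * fock_complete (int (n - Suc k))"
          unfolding fock_complete_newton
          by (rule sum.cong) (use True in \<open>auto simp: of_nat_diff algebra_simps\<close>)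
        finally show ?thesis
          using True by (simp add: of_nat_diff distrib_right [symmetric])
      next
        case False
        then show ?thesis
          by simp
      qed
      finally show ?thesis
        using False of_nat_mult_fock_cancel by blast
    qed simp
  qed
  then show ?thesis
    by (cases "a \<ge> 0") (metis nonneg_int_cases, simp)
qed

text \<open>Replacing \<open>p_r\<close> by \<open>p_r + t^r\<close> multiplies
  \<open>sum_a h_a z^a\<close> by \<open>exp (sum_r (t z)^r / r) = 1 / (1 - t z)\<close>. In the
  recurrence, each of the \<open>n\<close> values of \<open>i\<close> contributes the same
  \<open>h_(a-n)\<close>.\<close>

lemma translate_fock_complete: "translate 1 k (fock_complete a) = fock_complete (a - int k)"
proof -
  have "of_nat n * fock_complete (a - int n) = fock_const 1 *
      (\<Sum>i\<le>n. of_nat i * pderivative (i - 1) (fock_complete (a - int (n - i))))" for n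
  proof -
    have "(\<Sum>i\<le>n. of_nat i * pderivative (i - 1) (fock_complete (a - int (n - i)))) =
        (\<Sum>i=1..n. of_nat i * pderivative (i - 1) (fock_complete (a - int (n - i))))"
      by (rule sum.mono_neutral_right) auto
    also have "\<dots> = (\<Sum>i=1..n. fock_complete (a - int n))"
    proof (rule sum.cong)
      fix i assume "i \<in> {1..n}"
      then have "Suc (i - 1) = i" "a - int (n - i) - int i = a - int n"
        by auto
      then show "of_nat i * pderivative (i - 1) (fock_complete (a - int (n - i))) = fock_complete (a - int n)"
        using pderivative_fock_complete [of "i - 1"] by metis
    qed simp
    finally show ?thesis
      by (simp add: fock_const_simps)
  qed
  from translate_unique [of "\<lambda>n. fock_complete (a - int n)", OF this] show ?thesis
    by simp
qed


section \<open>The grading\<close>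

text \<open>The degree in which \<open>b_{-n}\<close> has degree \<open>n\<close>; the variable of
  index \<open>i\<close> is \<open>b_{-(i+1)}\<close>, hence the factor
  \<open>Suc i\<close>.\<close>

definition weight :: "(nat \<Rightarrow>\<^sub>0 nat) \<Rightarrow> nat" where
  "weight m = (\<Sum>i \<in> Poly_Mapping.keys m. Suc i * Poly_Mapping.lookup m i)"

lemma weight_superset:
  assumes "finite A" "Poly_Mapping.keys m \<subseteq> A"
  shows "weight m = (\<Sum>i \<in> A. Suc i * Poly_Mapping.lookup m i)"
  unfolding weight_def
  by (rule sum.mono_neutral_left) (use assms in \<open>auto simp: in_keys_iff\<close>)

lemma weight_add: "weight (m + m') = weight m + weight m'"
proof -
  let ?A = "Poly_Mapping.keys m \<union> Poly_Mapping.keys m'"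
  have "Poly_Mapping.keys (m + m') \<subseteq> ?A"
    by (rule keys_add)
  then show ?thesis
    by (simp add: weight_superset [of ?A] lookup_add distrib_left sum.distrib del: mult_Suc)
qed

lemma weight_0 [simp]: "weight 0 = 0"
  by (simp add: weight_def)

lemma weight_single [simp]: "weight (Poly_Mapping.single i k) = Suc i * k"
  by (cases "k = 0") (simp_all add: weight_def)

text \<open>Sets of weights express homogeneity as \<open>{d}\<close> and a degree bound as
  \<open>{..d}\<close>. They consist of integers so that they can be shifted below 0, where
  \<open>weights_in_eq_0\<close> yields vanishing.\<close>

definition weights_in :: "int set \<Rightarrow> fock \<Rightarrow> bool" where
  "weights_in A f \<longleftrightarrow> (\<forall>m \<in> Poly_Mapping.keys f. int (weight m) \<in> A)"

lemma weights_in_0 [simp]: "weights_in A 0"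
  by (simp add: weights_in_def)

lemma weights_in_mono: "weights_in A f \<Longrightarrow> A \<inter> {0..} \<subseteq> B \<Longrightarrow> weights_in B f"
  by (auto simp: weights_in_def)

lemma weights_in_eq_0: "weights_in A f \<Longrightarrow> A \<inter> {0..} = {} \<Longrightarrow> f = 0"
  unfolding weights_in_def keys_eq_empty [symmetric] by fastforce

lemma weights_in_add: "weights_in A f \<Longrightarrow> weights_in A g \<Longrightarrow> weights_in A (f + g)"
  using keys_add [of f g] by (auto simp: weights_in_def)

lemma weights_in_sum: "(\<And>x. x \<in> X \<Longrightarrow> weights_in A (f x)) \<Longrightarrow> weights_in A (sum f X)"
  by (induction X rule: infinite_finite_induct) (simp_all add: weights_in_add)

lemma weights_in_mult:
  assumes "weights_in A f" "weights_in B g" "\<And>a b. a \<in> A \<Longrightarrow> b \<in> B \<Longrightarrow> a + b \<in> C"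
  shows "weights_in C (f * g)"
  unfolding weights_in_def
proof
  fix m assume "m \<in> Poly_Mapping.keys (f * g)"
  then obtain a b where "m = a + b" "a \<in> Poly_Mapping.keys f" "b \<in> Poly_Mapping.keys g"
    using keys_mult [of f g] by blast
  then show "int (weight m) \<in> C"
    using assms by (simp add: weights_in_def weight_add)
qed

lemma weights_in_const: "0 \<in> A \<Longrightarrow> weights_in A (fock_const c)"
  by (cases "c = 0") (simp_all add: weights_in_def)

lemma weights_in_one: "0 \<in> A \<Longrightarrow> weights_in A 1"
  using weights_in_const [of A 1] by (simp add: fock_const_simps)

lemma weights_in_var: "int (Suc i) \<in> A \<Longrightarrow> weights_in A (fock_var i)"
  by (simp add: weights_in_def)

lemma weights_in_const_mult: "weights_in A f \<Longrightarrow> weights_in A (fock_const c * f)"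
  by (rule weights_in_mult [OF weights_in_const [of "{0}"]]) auto

lemma weights_in_of_nat_mult: "weights_in A f \<Longrightarrow> weights_in A (of_nat n * f)"
  using weights_in_const_mult [of A f "of_nat n"] by simp

lemma weights_in_of_nat_mult_cancel:
  assumes "weights_in A (of_nat n * f)" "n > 0"
  shows "weights_in A f"
proof -
  have "fock_const (1 / of_nat n) * (of_nat n * f) = f"
    using assms(2) by (simp only: of_nat_eq_fock_const fock_const_simps) (simp add: fock_const_simps)
  with weights_in_const_mult [OF assms(1), of "1 / of_nat n"] show ?thesis
    by simp
qed

lemma weights_in_pderivative:
  assumes "weights_in A f"
  shows "weights_in {a. a + int (Suc k) \<in> A} (pderivative k f)"
proof -
  have "weights_in {a. a + int (Suc k) \<in> A} (Poly_Mapping.single (m - Poly_Mapping.single k 1)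
      (of_nat (Poly_Mapping.lookup m k) * Poly_Mapping.lookup f m))"
    if "m \<in> Poly_Mapping.keys f" for m
  proof (cases "Poly_Mapping.lookup m k = 0")
    case False
    then have "m - Poly_Mapping.single k 1 + Poly_Mapping.single k 1 = m"
      by (intro poly_mapping_eqI) (auto simp: lookup_add lookup_minus lookup_single when_def)
    then have "weight m = weight (m - Poly_Mapping.single k 1) + Suc k"
      by (metis mult.right_neutral weight_add weight_single)
    moreover have "int (weight m) \<in> A"
      using assms that by (simp add: weights_in_def)
    ultimately show ?thesis
      by (simp add: weights_in_def algebra_simps)
  qed simp
  then show ?thesis
    unfolding pderivative_def by (rule weights_in_sum)
qed

lemma weights_in_translate:
  assumes "weights_in A f"
  shows "weights_in {a. a + int n \<in> A} (translate c n f)"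
proof (induction n rule: less_induct)
  case (less n)
  show ?case
  proof (cases "n = 0")
    case False
    have "weights_in {a. a + int n \<in> A} (of_nat i * pderivative (i - 1) (translate c (n - i) f))"
      if "i \<le> n" for i
    proof (cases "i = 0")
      case i: False
      have "weights_in {a. a + int (n - i) \<in> A} (translate c (n - i) f)"
        using less i \<open>n \<noteq> 0\<close> by simp
      from weights_in_pderivative [OF this, of "i - 1"] show ?thesis
        using i that by (intro weights_in_of_nat_mult) (simp add: of_nat_diff algebra_simps)
    qed simp
    then have "weights_in {a. a + int n \<in> A} (of_nat n * translate c n f)"
      unfolding translate_derivative by (intro weights_in_const_mult weights_in_sum) simp
    from weights_in_of_nat_mult_cancel [OF this] False show ?thesis
      by simp
  qed (use assms in simp)
qed

lemma weights_in_fock_complete: "weights_in {a} (fock_complete a)"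
proof -
  have "weights_in {int n} (fock_complete (int n))" for n
  proof (induction n rule: less_induct)
    case (less n)
    show ?case
    proof (cases "n = 0")
      case False
      have "weights_in {int n} (fock_var (i - 1) * fock_complete (int (n - i)))" if "i \<in> {1..n}" for i
      proof (rule weights_in_mult)
        show "weights_in {int i} (fock_var (i - 1))"
          by (rule weights_in_var) (use that in auto)
        show "weights_in {int (n - i)} (fock_complete (int (n - i)))"
          by (rule less) (use that in auto)
      qed (use that in auto)
      then have "weights_in {int n} (of_nat n * fock_complete (int n))"
        unfolding fock_complete_newton by (rule weights_in_sum)
      from weights_in_of_nat_mult_cancel [OF this] False show ?thesis
        by simp
    qed (simp add: weights_in_one)
  qed
  then show ?thesis
    by (cases "a \<ge> 0") (metis nonneg_int_cases, simp)
qed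

lemma obtain_weight_bound:
  obtains d where "weights_in {..int d} f"
proof
  show "weights_in {..int (\<Sum>m \<in> Poly_Mapping.keys f. weight m)} f"
    unfolding weights_in_def by (intro ballI) (simp add: member_le_sum del: of_nat_sum)
qed

lemma weights_in_atMost_translate: "weights_in {..d} f \<Longrightarrow> weights_in {..d} (translate c n f)"
  by (rule weights_in_mono [OF weights_in_translate]) auto

lemma translate_eq_0: "weights_in {..int d} f \<Longrightarrow> n > d \<Longrightarrow> translate c n f = 0"
  by (rule weights_in_eq_0 [OF weights_in_translate]) auto


section \<open>Vertex operators and Schur functions of tuples\<close>

text \<open>Beyond the degree of \<open>f\<close> the translates vanish, and complete functions of
  negative index absorb the case distinction in \<open>vertex_S\<close>. Leaving \<open>d\<close>
  free lets several elements share one bound.\<close>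

lemma vertex_S_eq_sum:
  assumes "weights_in {..int d} f"
  shows "vertex_S (- a) f = (\<Sum>j\<le>d. fock_complete (a + int j) * translate (- 1) j f)"
proof -
  let ?g = "\<lambda>j. if - a \<le> int j then E_plus (nat (int j - - a)) (E_minus j f) else 0"
  have g: "?g j = fock_complete (a + int j) * translate (- 1) j f" for j
    by (simp add: E_plus_eq_fock_complete E_minus_eq_translate algebra_simps)
  then have "Sum_any ?g = sum ?g {..d}"
    by (intro Sum_any.expand_superset) (auto, meson assms not_le_imp_less mult_zero_right translate_eq_0)
  then show ?thesis
    by (simp only: vertex_S_def g)
qed

lemma fock_linear_vertex_S: "fock_linear (vertex_S k)"
  unfolding fock_linear_def
proof (intro conjI allI)
  fix f g :: fock
  obtain d where d: "weights_in {..int d} f"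
    by (rule obtain_weight_bound)
  obtain e where e: "weights_in {..int e} g"
    by (rule obtain_weight_bound)
  have "weights_in {..int (d + e)} f" "weights_in {..int (d + e)} g"
    by (rule weights_in_mono [OF d] weights_in_mono [OF e], force)+
  then show "vertex_S k (f + g) = vertex_S k f + vertex_S k g"
    using vertex_S_eq_sum [of "d + e" _ "- k"]
    by (simp add: weights_in_add translate_add distrib_left sum.distrib)
  fix c
  show "vertex_S k (fock_const c * f) = fock_const c * vertex_S k f"
    using vertex_S_eq_sum [of d _ "- k"] d
    by (simp add: weights_in_const_mult translate_const_mult sum_distrib_left mult.left_commute)
qed

lemma weights_in_vertex_S:
  assumes "weights_in {d} f"
  shows "weights_in {a + d} (vertex_S (- a) f)"
proof -
  have "weights_in {..int (nat d)} f"
    by (rule weights_in_mono [OF assms]) auto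
  moreover have "weights_in {a + d} (fock_complete (a + int j) * translate (- 1) j f)" for j
    by (rule weights_in_mult [OF weights_in_fock_complete weights_in_translate [OF assms]]) auto
  ultimately show ?thesis
    by (simp only: vertex_S_eq_sum weights_in_sum)
qed

text \<open>Both sides collect all nonzero values of \<open>\<phi>\<close>, the left one by total
  index. This converts Cauchy products into independent sums and back.\<close>

lemma sum_triangle_eq_box:
  fixes \<phi> :: "nat \<Rightarrow> nat \<Rightarrow> 'a :: comm_monoid_add"
  assumes "\<And>i j. \<phi> i j \<noteq> 0 \<Longrightarrow> i \<le> p \<and> j \<le> q \<and> i + j \<le> n"
  shows "(\<Sum>k\<le>n. \<Sum>i\<le>k. \<phi> i (k - i)) = (\<Sum>i\<le>p. \<Sum>j\<le>q. \<phi> i j)"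
proof -
  have fin: "finite {(i, j). i + j \<le> n}"
    by (rule finite_subset [of _ "{..n} \<times> {..n}"]) auto
  have "(\<Sum>k\<le>n. \<Sum>i\<le>k. \<phi> i (k - i)) = (\<Sum>(i, j) \<in> {(i, j). i + j \<le> n}. \<phi> i j)"
    by (rule sum.triangle_reindex_eq [symmetric])
  also have "\<dots> = (\<Sum>(i, j) \<in> {..p} \<times> {..q} \<inter> {(i, j). i + j \<le> n}. \<phi> i j)"
    by (rule sum.mono_neutral_right [OF fin]) (use assms in blast, use assms in fast)
  also have "\<dots> = (\<Sum>(i, j) \<in> {..p} \<times> {..q}. \<phi> i j)"
    by (rule sum.mono_neutral_left) (use assms in auto)
  finally show ?thesis
    by (simp add: sum.cartesian_product)
qed

text \<open>
  Multiplying \<open>E_plus(z) E_minus(1/z) f\<close> by \<open>g\<close> moves \<open>g\<close> through \<open>E_minus(1/z)\<close>, which is a ring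
  homomorphism with inverse \<open>\<Sum>k. translate 1 k z\<^sup>-\<^sup>k\<close>.
\<close>

lemma vertex_S_mult:
  assumes e: "weights_in {..int e} g"
  shows "vertex_S (- a) f * g = (\<Sum>k\<le>e. vertex_S (- (a + int k)) (f * translate 1 k g))"
proof -
  obtain d where d: "weights_in {..int d} f"
    by (rule obtain_weight_bound)
  define D where "D = translate (- 1)"
  define G where "G = translate 1"
  have D0: "i \<le> d" if "D i f \<noteq> 0" for i
    using translate_eq_0 [OF d, of i] that unfolding D_def by (meson not_le)
  \<comment> \<open>Together \<open>G k\<close> and \<open>D l\<close> lower the weight by
    \<open>k + l\<close>, and \<open>g\<close> has weight at most \<open>e\<close>.\<close>
  have DG0: "k + l \<le> e" if "D l (G k g) \<noteq> 0" for k l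
  proof (rule ccontr)
    assume "\<not> k + l \<le> e"
    then have "D l (G k g) = 0"
      unfolding D_def G_def
      by (intro weights_in_eq_0 [OF weights_in_translate [OF weights_in_translate [OF e]]]) auto
    with that show False
      by simp
  qed
  \<comment> \<open>Multiplicativity of \<open>D\<close> separates the index \<open>i\<close> acting
    on \<open>f\<close> from the index \<open>l\<close> acting on \<open>G k g\<close>.\<close>
  have 1: "vertex_S (- (a + int k)) (f * G k g) =
      (\<Sum>i\<le>d. \<Sum>l\<le>e. fock_complete (a + int i + int (l + k)) * (D i f * D l (G k g)))" for k
  proof -
    let ?\<phi> = "\<lambda>i l. fock_complete (a + int i + int (l + k)) * (D i f * D l (G k g))"
    have "weights_in {..int (d + e)} (f * G k g)"
      unfolding G_def by (rule weights_in_mult [OF d weights_in_atMost_translate [OF e]]) auto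
    then have "vertex_S (- (a + int k)) (f * G k g) =
        (\<Sum>j\<le>d + e. fock_complete (a + int k + int j) * D j (f * G k g))"
      unfolding D_def by (rule vertex_S_eq_sum)
    also have "\<dots> = (\<Sum>j\<le>d + e. \<Sum>i\<le>j. ?\<phi> i (j - i))"
      by (simp add: D_def translate_mult sum_distrib_left algebra_simps)
    also have "\<dots> = (\<Sum>i\<le>d. \<Sum>l\<le>e. ?\<phi> i l)"
      by (rule sum_triangle_eq_box) (use D0 DG0 add_leD2 add_mono in \<open>fastforce\<close>)
    finally show ?thesis .
  qed
  \<comment> \<open>Grouped by \<open>r = l + k\<close>, the inner sums are the coefficients of the
    identity series, so only \<open>r = 0\<close> survives.\<close>
  have 2: "(\<Sum>l\<le>e. \<Sum>k\<le>e. fock_complete (b + int (l + k)) * D l (G k g)) = fock_complete b * g" for b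
  proof -
    have "(\<Sum>l\<le>e. \<Sum>k\<le>e. fock_complete (b + int (l + k)) * D l (G k g)) =
        (\<Sum>r\<le>e. \<Sum>l\<le>r. fock_complete (b + int (l + (r - l))) * D l (G (r - l) g))"
      by (rule sum_triangle_eq_box [symmetric]) (use DG0 in fastforce)
    also have "\<dots> = (\<Sum>r\<le>e. fock_complete (b + int r) * (if r = 0 then g else 0))"
      unfolding translate_inverse [of 1, symmetric] D_def G_def sum_distrib_left
      by (intro sum.cong refl) simp
    also have "\<dots> = fock_complete b * g"
      by (simp add: if_distrib cong: if_cong)
    finally show ?thesis .
  qed
  have "(\<Sum>k\<le>e. vertex_S (- (a + int k)) (f * G k g)) = (\<Sum>i\<le>d. \<Sum>l\<le>e. \<Sum>k\<le>e.
      D i f * (fock_complete (a + int i + int (l + k)) * D l (G k g)))"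
    unfolding 1
    by (subst sum.swap, rule sum.cong [OF refl], subst sum.swap) (simp only: mult.left_commute)
  also have "\<dots> = (\<Sum>i\<le>d. D i f * (fock_complete (a + int i) * g))"
    by (simp only: sum_distrib_left [symmetric] 2)
  also have "\<dots> = vertex_S (- a) f * g"
    by (simp add: vertex_S_eq_sum [OF d] D_def sum_distrib_left algebra_simps)
  finally show ?thesis
    by (simp add: G_def)
qed

lemma translate_vertex_S:
  "translate 1 k (vertex_S (- b) f) = (\<Sum>i\<le>k. vertex_S (- (b - int i)) (translate 1 (k - i) f))"
proof -
  obtain d where d: "weights_in {..int d} f"
    by (rule obtain_weight_bound)
  have "translate 1 k (vertex_S (- b) f) =
      (\<Sum>j\<le>d. \<Sum>i\<le>k. fock_complete (b + int j - int i) * translate 1 (k - i) (translate (- 1) j f))"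
    by (simp add: vertex_S_eq_sum [OF d] translate_sum translate_mult translate_fock_complete)
  also have "\<dots> = (\<Sum>i\<le>k. \<Sum>j\<le>d. fock_complete (b - int i + int j) * translate (- 1) j (translate 1 (k - i) f))"
    by (subst sum.swap) (simp add: translate_commute [of 1] algebra_simps)
  also have "\<dots> = (\<Sum>i\<le>k. vertex_S (- (b - int i)) (translate 1 (k - i) f))"
    by (simp only: vertex_S_eq_sum [OF weights_in_atMost_translate [OF d]])
  finally show ?thesis .
qed

section \<open>Schur functions of integer tuples inside the Fock space\<close>

definition schur_fock :: "int list \<Rightarrow> fock" where
  "schur_fock \<nu> = foldr (\<lambda>a f. vertex_S (- a) f) \<nu> 1"

lemma schur_fock_simps [simp]:
  "schur_fock [] = 1"
  "schur_fock (a # \<nu>) = vertex_S (- a) (schur_fock \<nu>)"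
  by (simp_all add: schur_fock_def)

lemma schur_eq_to_sym: "schur \<nu> = to_sym (schur_fock \<nu>)"
  by (simp add: schur_def schur_fock_def)

lemma weights_in_schur_fock: "weights_in {sum_list \<nu>} (schur_fock \<nu>)"
  by (induction \<nu>) (simp_all add: weights_in_one weights_in_vertex_S)

text \<open>\<open>schur_fock \<nu>\<close> is homogeneous of degree \<open>sum_list \<nu>\<close>,
  and linear operators keep it 0. This is what makes the sum over \<open>N\<close> in the product
  formula finite.\<close>

lemma schur_fock_append_eq_0:
  assumes "sum_list \<nu> < 0"
  shows "schur_fock (\<kappa> @ \<nu>) = 0"
proof (induction \<kappa>)
  case Nil
  show ?case
    using weights_in_eq_0 [OF weights_in_schur_fock [of \<nu>]] assms by simp
qed (simp add: fock_linear_0 [OF fock_linear_vertex_S])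

definition compositions :: "nat \<Rightarrow> nat \<Rightarrow> nat list set" where
  "compositions n k = {N. length N = n \<and> sum_list N = k}"

lemma finite_lists_sum_le: "finite {N :: nat list. length N = n \<and> sum_list N \<le> k}"
proof (rule finite_subset)
  show "{N :: nat list. length N = n \<and> sum_list N \<le> k} \<subseteq> {N. set N \<subseteq> {..k} \<and> length N = n}"
    using member_le_sum_list by fastforce
qed (rule finite_lists_length_eq, simp)

lemma finite_compositions: "finite (compositions n k)"
  by (rule finite_subset [OF _ finite_lists_sum_le [of n k]]) (auto simp: compositions_def)

lemma compositions_Suc:
  "compositions (Suc n) k = (\<lambda>(i, N). i # N) ` (SIGMA i:{..k}. compositions n (k - i))"
  by (force simp: compositions_def length_Suc_conv image_iff)

lemma translate_schur_fock:
  "translate 1 k (schur_fock \<mu>) =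
    (\<Sum>N \<in> compositions (length \<mu>) k. schur_fock (map2 (\<lambda>a i. a - int i) \<mu> N))"
proof (induction \<mu> arbitrary: k)
  case Nil
  have "compositions 0 k = (if k = 0 then {[]} else {})"
    by (auto simp: compositions_def)
  then show ?case
    by (simp add: translate_one)
next
  case (Cons b \<mu>)
  have "translate 1 k (schur_fock (b # \<mu>)) = (\<Sum>i\<le>k. \<Sum>N \<in> compositions (length \<mu>) (k - i).
      schur_fock (map2 (\<lambda>a i. a - int i) (b # \<mu>) (i # N)))"
    by (simp add: translate_vertex_S Cons fock_linear_sum [OF fock_linear_vertex_S])
  also have "\<dots> = (\<Sum>(i, N) \<in> (SIGMA i:{..k}. compositions (length \<mu>) (k - i)).
      schur_fock (map2 (\<lambda>a i. a - int i) (b # \<mu>) (i # N)))"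
    by (rule sum.Sigma) (auto simp: finite_compositions)
  also have "\<dots> = (\<Sum>N \<in> compositions (length (b # \<mu>)) k. schur_fock (map2 (\<lambda>a i. a - int i) (b # \<mu>) N))"
    unfolding list.size(4) add_Suc_right add_0_right compositions_Suc
    by (subst sum.reindex) (auto simp: inj_on_def case_prod_unfold)
  finally show ?case .
qed


section \<open>The product formula\<close>

text \<open>Matrices are lists of rows, so that removing the first row is the induction step.\<close>

definition row_matrices :: "nat \<Rightarrow> nat \<Rightarrow> nat \<Rightarrow> nat list list set" where
  "row_matrices m n e = {K. length K = m \<and> (\<forall>r \<in> set K. length r = n) \<and> sum_list (map sum_list K) \<le> e}"

text \<open>The number of columns is an explicit argument because a matrix without rows does not
  determine it.\<close>

definition column_sums :: "nat \<Rightarrow> nat list list \<Rightarrow> nat list" where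
  "column_sums n K = foldr (map2 (+)) K (replicate n 0)"

lemma column_sums_simps [simp]:
  "column_sums n [] = replicate n 0"
  "column_sums n (r # K) = map2 (+) r (column_sums n K)"
  by (simp_all add: column_sums_def)

lemma length_column_sums: "\<forall>r \<in> set K. length r = n \<Longrightarrow> length (column_sums n K) = n"
  by (induction K) simp_all

lemma finite_row_matrices: "finite (row_matrices m n e)"
proof (rule finite_subset)
  have "sum_list r \<le> sum_list (map sum_list K)" if "r \<in> set K" for r :: "nat list" and K
    using that by (intro member_le_sum_list) simp_all
  then show "row_matrices m n e \<subseteq> {K. set K \<subseteq> {N. length N = n \<and> sum_list N \<le> e} \<and> length K = m}"
    unfolding row_matrices_def using le_trans by blast
qed (rule finite_lists_length_eq, rule finite_lists_sum_le)

text \<open>The bound \<open>e\<close> on the total of the entries keeps the sum finite and fits the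
  induction: a first row of sum \<open>k\<close> lowers the sum of \<open>\<mu>\<close> by
  \<open>k\<close> and leaves \<open>e - k\<close> for the remaining rows.\<close>

lemma schur_fock_mult:
  assumes "sum_list \<mu> \<le> int e"
  shows "schur_fock lam * schur_fock \<mu> = (\<Sum>K \<in> row_matrices (length lam) (length \<mu>) e.
    schur_fock (shifted lam \<mu> (map sum_list K) (column_sums (length \<mu>) K)))"
  using assms
proof (induction lam arbitrary: \<mu> e)
  case Nil
  have "row_matrices 0 (length \<mu>) e = {[]}"
    by (auto simp: row_matrices_def)
  moreover have "map2 (\<lambda>a k. a - int k) \<mu> (replicate (length \<mu>) 0) = \<mu>"
    by (rule nth_equalityI) simp_all
  ultimately show ?case
    by (simp add: shifted_def)
next
  case (Cons a lam)
  define n where "n = length \<mu>"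
  define R where "R = row_matrices (length lam) n"
  define s where "s K = schur_fock (shifted (a # lam) \<mu> (map sum_list K) (column_sums n K))" for K
  \<comment> \<open>\<open>N\<close> is the first row and \<open>k\<close> its sum; the induction
    hypothesis for the lowered \<open>\<mu>\<close> supplies the other rows.\<close>
  have step: "vertex_S (- (a + int k)) (schur_fock lam * schur_fock (map2 (\<lambda>a i. a - int i) \<mu> N)) =
      (\<Sum>K \<in> R (e - k). s (N # K))" if "k \<le> e" "N \<in> compositions n k" for k N
  proof -
    let ?\<mu>' = "map2 (\<lambda>a i. a - int i) \<mu> N"
    have N: "length N = length \<mu>" "sum_list N = k"
      using that by (auto simp: compositions_def n_def)
    have "sum_list ?\<mu>' = sum_list \<mu> - int (sum_list N)"
      using N(1) by (induction N \<mu> rule: list_induct2) auto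
    then have "sum_list ?\<mu>' \<le> int (e - k)"
      using Cons.prems N(2) that(1) by simp
    from Cons.IH [OF this] have "vertex_S (- (a + int k)) (schur_fock lam * schur_fock ?\<mu>') =
        (\<Sum>K \<in> R (e - k). schur_fock ((a + int k) # shifted lam ?\<mu>' (map sum_list K) (column_sums n K)))"
      using N(1) by (simp add: R_def n_def fock_linear_sum [OF fock_linear_vertex_S])
    also have "\<dots> = (\<Sum>K \<in> R (e - k). s (N # K))"
    proof (rule sum.cong)
      fix K assume "K \<in> R (e - k)"
      then have "length (column_sums n K) = n"
        by (intro length_column_sums) (simp add: R_def row_matrices_def)
      then have "map2 (\<lambda>a i. a - int i) ?\<mu>' (column_sums n K) =
          map2 (\<lambda>a i. a - int i) \<mu> (map2 (+) N (column_sums n K))"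
        using N by (intro nth_equalityI) (simp_all add: n_def)
      then show "schur_fock ((a + int k) # shifted lam ?\<mu>' (map sum_list K) (column_sums n K)) = s (N # K)"
        using N(2) by (simp add: s_def shifted_def)
    qed simp
    finally show ?thesis .
  qed
  have "weights_in {..int e} (schur_fock \<mu>)"
    by (rule weights_in_mono [OF weights_in_schur_fock]) (use Cons.prems in auto)
  then have "schur_fock (a # lam) * schur_fock \<mu> = (\<Sum>k\<le>e. \<Sum>N \<in> compositions n k.
      vertex_S (- (a + int k)) (schur_fock lam * schur_fock (map2 (\<lambda>a i. a - int i) \<mu> N)))"
    by (simp add: vertex_S_mult translate_schur_fock n_def sum_distrib_left
        fock_linear_sum [OF fock_linear_vertex_S])
  also have "\<dots> = (\<Sum>k\<le>e. \<Sum>N \<in> compositions n k. \<Sum>K \<in> R (e - k). s (N # K))"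
    by (intro sum.cong refl step) auto
  also have "\<dots> = (\<Sum>k\<le>e. \<Sum>(N, K) \<in> compositions n k \<times> R (e - k). s (N # K))"
    by (simp add: sum.cartesian_product)
  also have "\<dots> = (\<Sum>(k, N, K) \<in> (SIGMA k:{..e}. compositions n k \<times> R (e - k)). s (N # K))"
    by (subst sum.Sigma) (auto simp: finite_compositions R_def finite_row_matrices case_prod_unfold)
  also have "\<dots> = (\<Sum>K \<in> row_matrices (length (a # lam)) n e. s K)"
    by (rule sum.reindex_bij_witness [where i = "\<lambda>K. (sum_list (hd K), hd K, tl K)"
          and j = "\<lambda>(k, N, K). N # K"])
      (auto simp: row_matrices_def R_def compositions_def length_Suc_conv)
  finally show ?case
    by (simp only: s_def n_def)
qed


section \<open>The identification with symmetric functions\<close>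

lemma coeff_mfps_const: "coeff (mfps_const c) m = (if m = 0 then c else 0)"
  by (simp add: mfps_const_def)

lemma coeff_mfps_const_mult: "coeff (mfps_const c * f) m = c * coeff f m"
proof -
  have "coeff (mfps_const c * f) m = (\<Sum>x \<in> {(0, m)}. coeff (mfps_const c) (fst x) * coeff f (snd x))"
    unfolding coeff_mult case_prod_unfold
    by (rule sum.mono_neutral_right)
      (use finite_splits [of m] in \<open>auto simp: coeff_mfps_const case_prod_unfold\<close>)
  then show ?thesis
    by (simp add: coeff_mfps_const)
qed

lemma coeff_sum: "coeff (sum f A) m = (\<Sum>x \<in> A. coeff (f x) m)"
  by (induction A rule: infinite_finite_induct) (simp_all add: coeff_simps)

lemma mfps_const_add: "mfps_const (c + d) = mfps_const c + mfps_const d"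
  and mfps_const_mult: "mfps_const (c * d) = mfps_const c * mfps_const d"
  and mfps_const_0 [simp]: "mfps_const 0 = 0"
  and mfps_const_1 [simp]: "mfps_const 1 = 1"
  by (auto intro!: mfps_eqI simp: coeff_mfps_const coeff_simps coeff_mfps_const_mult coeff_one)

definition power_sum_monomial :: "(nat \<Rightarrow>\<^sub>0 nat) \<Rightarrow> rat mfps" where
  "power_sum_monomial m = (\<Prod>i \<in> Poly_Mapping.keys m. power_sum (i + 1) ^ Poly_Mapping.lookup m i)"

lemma power_sum_monomial_add:
  "power_sum_monomial (m + m') = power_sum_monomial m * power_sum_monomial m'"
proof -
  let ?A = "Poly_Mapping.keys m \<union> Poly_Mapping.keys m'"
  have *: "power_sum_monomial k = (\<Prod>i \<in> ?A. power_sum (i + 1) ^ Poly_Mapping.lookup k i)"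
    if "Poly_Mapping.keys k \<subseteq> ?A" for k
    unfolding power_sum_monomial_def
    by (rule prod.mono_neutral_left) (use that in \<open>auto simp: in_keys_iff\<close>)
  show ?thesis
    by (simp add: * keys_add lookup_add power_add prod.distrib)
qed

lemma to_sym_superset:
  assumes "finite A" "Poly_Mapping.keys f \<subseteq> A"
  shows "to_sym f = (\<Sum>m \<in> A. mfps_const (Poly_Mapping.lookup f m) * power_sum_monomial m)"
  unfolding to_sym_def power_sum_monomial_def [symmetric]
  by (rule sum.mono_neutral_left) (use assms in \<open>auto simp: in_keys_iff\<close>)

lemma to_sym_single: "to_sym (Poly_Mapping.single m c) = mfps_const c * power_sum_monomial m"
  by (subst to_sym_superset [where A = "{m}"]) auto

lemma to_sym_add: "to_sym (f + g) = to_sym f + to_sym g"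
proof -
  let ?A = "Poly_Mapping.keys f \<union> Poly_Mapping.keys g"
  have "Poly_Mapping.keys (f + g) \<subseteq> ?A"
    by (rule keys_add)
  then show ?thesis
    by (simp add: to_sym_superset [of ?A] lookup_add mfps_const_add distrib_right sum.distrib)
qed

lemma to_sym_mult: "to_sym (f * g) = to_sym f * to_sym g"
proof -
  have "to_sym (Poly_Mapping.single m c * g) = to_sym (Poly_Mapping.single m c) * to_sym g" for m c
    by (induction g rule: poly_mapping_single_induct)
      (simp_all add: mult_single to_sym_single mfps_const_mult power_sum_monomial_add
        to_sym_add algebra_simps)
  then show ?thesis
    by (induction f rule: poly_mapping_single_induct) (simp_all add: distrib_right to_sym_add)
qed

lemma to_sym_const: "to_sym (fock_const c) = mfps_const c"
  by (simp add: to_sym_single power_sum_monomial_def)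

lemma to_sym_simps [simp]: "to_sym 0 = 0" "to_sym 1 = 1"
  using to_sym_const [of 0] to_sym_const [of 1] by (simp_all add: fock_const_simps)

lemma to_sym_var: "to_sym (fock_var i) = power_sum (Suc i)"
  by (simp add: to_sym_single power_sum_monomial_def)

lemma to_sym_sum: "to_sym (sum f A) = (\<Sum>x \<in> A. to_sym (f x))"
  by (induction A rule: infinite_finite_induct) (simp_all add: to_sym_add)

lemma to_sym_uminus: "to_sym (- f) = - to_sym f"
  using to_sym_add [of f "- f"] by (simp add: eq_neg_iff_add_eq_0 add.commute)

section \<open>Matrices with prescribed row and column sums\<close>

lemma nth_column_sums:
  assumes "\<forall>r \<in> set K. length r = n" "j < n"
  shows "column_sums n K ! j = (\<Sum>i<length K. K ! i ! j)"
  using assms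
  by (induction K) (simp_all add: sum.lessThan_Suc_shift length_column_sums del: sum.lessThan_Suc)

lemma sum_list_column_sums:
  "\<forall>r \<in> set K. length r = n \<Longrightarrow> sum_list (column_sums n K) = sum_list (map sum_list K)"
proof (induction K)
  case (Cons r K)
  have "sum_list (map2 (+) xs ys) = sum_list xs + sum_list ys"
    if "length xs = length ys" for xs ys :: "nat list"
    using that by (induction xs ys rule: list_induct2) auto
  with Cons show ?case
    by (simp add: length_column_sums)
qed simp

text \<open>Functions on the index rectangle correspond to lists of rows. The bound \<open>e\<close>
  is automatic, since the entries add up to \<open>sum_list N\<close>.\<close>

lemma matrix_count_eq_card_row_matrices:
  assumes "length N = n" "sum_list N \<le> e"
  shows "matrix_count M N =
    card {K \<in> row_matrices (length M) n e. (map sum_list K, column_sums n K) = (M, N)}"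
proof -
  define m where "m = length M"
  define A where "A = {k \<in> ({..<m} \<times> {..<n}) \<rightarrow>\<^sub>E (UNIV :: nat set).
     map (\<lambda>i. \<Sum>j<n. k (i, j)) [0..<m] = M \<and> map (\<lambda>j. \<Sum>i<m. k (i, j)) [0..<n] = N}"
  define B where "B = {K. length K = m \<and> (\<forall>r \<in> set K. length r = n) \<and>
    map sum_list K = M \<and> column_sums n K = N}"
  define \<Phi> where "\<Phi> k = map (\<lambda>i. map (\<lambda>j. k (i, j)) [0..<n]) [0..<m]" for k :: "nat \<times> nat \<Rightarrow> nat"
  define \<Psi> where "\<Psi> K = restrict (\<lambda>(i, j). K ! i ! j) ({..<m} \<times> {..<n})" for K :: "nat list list"
  have \<Phi>: "length (\<Phi> k) = m" "\<forall>r \<in> set (\<Phi> k). length r = n" "i < m \<Longrightarrow> length (\<Phi> k ! i) = n"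
    "i < m \<Longrightarrow> j < n \<Longrightarrow> \<Phi> k ! i ! j = k (i, j)" for k i j
    by (auto simp: \<Phi>_def)
  have rows: "map sum_list K = map (\<lambda>i. \<Sum>j<n. K ! i ! j) [0..<m]"
    if "length K = m" "\<forall>r \<in> set K. length r = n" for K :: "nat list list"
    using that by (intro nth_equalityI) (auto simp: sum_list_sum_nth atLeast0LessThan)
  have cols: "column_sums n K = map (\<lambda>j. \<Sum>i<m. K ! i ! j) [0..<n]"
    if "length K = m" "\<forall>r \<in> set K. length r = n" for K :: "nat list list"
    using that by (intro nth_equalityI) (auto simp: nth_column_sums length_column_sums)
  have "bij_betw \<Phi> A B"
  proof (rule bij_betw_byWitness [where f' = \<Psi>])
    show "\<forall>k \<in> A. \<Psi> (\<Phi> k) = k"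
      by (auto simp: A_def \<Psi>_def \<Phi> PiE_def extensional_def restrict_def fun_eq_iff)
    show "\<forall>K \<in> B. \<Phi> (\<Psi> K) = K"
      by (auto simp: B_def \<Psi>_def \<Phi> intro!: nth_equalityI)
    show "\<Phi> ` A \<subseteq> B"
      by (auto simp: A_def B_def rows [OF \<Phi>(1,2)] cols [OF \<Phi>(1,2)] \<Phi> intro!: nth_equalityI)
    show "\<Psi> ` B \<subseteq> A"
      by (auto simp: A_def B_def rows cols \<Psi>_def intro!: nth_equalityI split: if_splits)
  qed
  then have "card A = card B"
    by (rule bij_betw_same_card)
  moreover have "matrix_count M N = card A"
    using assms by (simp add: matrix_count_def A_def m_def)
  moreover have "B = {K \<in> row_matrices (length M) n e. (map sum_list K, column_sums n K) = (M, N)}"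
    using assms(2) by (auto simp: B_def row_matrices_def m_def sum_list_column_sums)
  ultimately show ?thesis
    by simp
qed

lemma matrix_count_neq_0_imp_sum_list_eq:
  assumes "matrix_count M N \<noteq> 0"
  shows "sum_list M = sum_list N"
proof -
  obtain k where k: "map (\<lambda>i. \<Sum>j<length N. k (i, j)) [0..<length M] = M"
      "map (\<lambda>j. \<Sum>i<length M. k (i, j)) [0..<length N] = N"
    using assms unfolding matrix_count_def by (auto simp: card_gt_0_iff)
  have "sum_list M = (\<Sum>i<length M. \<Sum>j<length N. k (i, j))"
    by (subst k(1) [symmetric]) (simp add: interv_sum_list_conv_sum_set_nat atLeast0LessThan)
  also have "\<dots> = (\<Sum>j<length N. \<Sum>i<length M. k (i, j))"
    by (rule sum.swap)
  also have "\<dots> = sum_list N"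
    by (subst (2) k(2) [symmetric]) (simp add: interv_sum_list_conv_sum_set_nat atLeast0LessThan)
  finally show ?thesis .
qed

text \<open>Grouping the matrices of \<open>schur_fock_mult\<close> by their sums produces the
  multiplicities. In a nonzero term \<open>M\<close> and \<open>N\<close> have equal sums, and this
  sum is at most that of \<open>\<mu>\<close>, as otherwise the tail of the shifted tuple has
  negative degree. So the finite box \<open>T\<close> contains all nonzero terms.\<close>

lemma schur_mult:
  fixes lam \<mu> :: "int list"
  defines "F \<equiv> \<lambda>(M, N). of_nat (matrix_count M N) * schur (shifted lam \<mu> M N)"
  defines "I \<equiv> {x \<in> tuples (length lam) \<times> tuples (length \<mu>). F x \<noteq> 0}"
  shows "finite I" "schur lam * schur \<mu> = (\<Sum>x \<in> I. F x)"
proof -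
  define n where "n = length \<mu>"
  define e where "e = nat (sum_list \<mu>)"
  define T where "T = {M :: nat list. length M = length lam \<and> sum_list M \<le> e} \<times>
    {N :: nat list. length N = n \<and> sum_list N \<le> e}"
  define R where "R = row_matrices (length lam) n e"
  define g where "g K = (map sum_list K, column_sums n K)" for K
  have "finite T"
    by (simp add: T_def finite_lists_sum_le)
  have "I \<subseteq> T"
  proof
    fix x assume "x \<in> I"
    then obtain M N where x: "x = (M, N)" and len: "length M = length lam" "length N = n"
      and F: "F (M, N) \<noteq> 0"
      by (auto simp: I_def tuples_def n_def)
    have neq: "schur (shifted lam \<mu> M N) \<noteq> 0"
      using F by (auto simp: F_def)
    have "matrix_count M N \<noteq> 0"
    proof
      assume "matrix_count M N = 0"
      with F show False
        by (simp add: F_def)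
    qed
    then have MN: "sum_list M = sum_list N"
      by (rule matrix_count_neq_0_imp_sum_list_eq)
    have "sum_list (map2 (\<lambda>a k. a - int k) \<mu> N) \<ge> 0"
      using neq unfolding shifted_def schur_eq_to_sym
      by (metis not_le schur_fock_append_eq_0 to_sym_simps(1))
    moreover have "sum_list (map2 (\<lambda>a k. a - int k) \<mu> N) = sum_list \<mu> - int (sum_list N)"
      using len(2) unfolding n_def by (induction N \<mu> rule: list_induct2) auto
    ultimately show "x \<in> T"
      using MN len by (simp add: x T_def e_def)
  qed
  with \<open>finite T\<close> show "finite I"
    by (rule finite_subset [rotated])
  have fibre: "F (M, N) = (\<Sum>K \<in> {K \<in> R. g K = (M, N)}. F' (g K))"
    if "(M, N) \<in> T" and F': "F' = (\<lambda>(M, N). schur (shifted lam \<mu> M N))" for M N F'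
  proof -
    have "(\<Sum>K \<in> {K \<in> R. g K = (M, N)}. F' (g K)) = (\<Sum>K \<in> {K \<in> R. g K = (M, N)}. F' (M, N))"
      by (rule sum.cong) auto
    also have "\<dots> = of_nat (matrix_count M N) * F' (M, N)"
      using that(1) by (simp add: matrix_count_eq_card_row_matrices [of N n e] T_def R_def g_def)
    finally show ?thesis
      by (simp add: F_def F')
  qed
  have "schur lam * schur \<mu> = to_sym (\<Sum>K \<in> R. schur_fock (shifted lam \<mu> (map sum_list K) (column_sums n K)))"
    unfolding schur_eq_to_sym to_sym_mult [symmetric] n_def R_def
    by (subst schur_fock_mult [of _ e]) (simp_all add: e_def)
  also have "\<dots> = (\<Sum>K \<in> R. (\<lambda>(M, N). schur (shifted lam \<mu> M N)) (g K))"
    by (simp add: to_sym_sum schur_eq_to_sym g_def)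
  also have "\<dots> = (\<Sum>x \<in> T. \<Sum>K \<in> {K \<in> R. g K = x}. (\<lambda>(M, N). schur (shifted lam \<mu> M N)) (g K))"
  proof (rule sum.group [symmetric])
    show "g ` R \<subseteq> T"
      by (auto simp: g_def R_def T_def row_matrices_def length_column_sums sum_list_column_sums)
  qed (simp_all add: \<open>finite T\<close> R_def finite_row_matrices)
  also have "\<dots> = (\<Sum>x \<in> T. F x)"
    by (rule sum.cong) (auto simp only: fibre [OF _ refl])
  also have "\<dots> = (\<Sum>x \<in> I. F x)"
    by (rule sum.mono_neutral_right [OF \<open>finite T\<close> \<open>I \<subseteq> T\<close>])
      (auto simp: I_def T_def tuples_def n_def)
  finally show "schur lam * schur \<mu> = (\<Sum>x \<in> I. F x)" .
qed


section \<open>Coefficients of symmetric functions\<close>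

text \<open>Exponent vectors as streams: \<open>k\<close> becomes the exponent of the first variable
  and all variables of \<open>m\<close> move up by one index.\<close>

definition mcons :: "nat \<Rightarrow> (nat \<Rightarrow>\<^sub>0 nat) \<Rightarrow> (nat \<Rightarrow>\<^sub>0 nat)" where
  "mcons k m = Abs_poly_mapping (case_nat k (Poly_Mapping.lookup m))"

lemma lookup_mcons:
  "Poly_Mapping.lookup (mcons k m) = case_nat k (Poly_Mapping.lookup m)"
proof -
  have "{i. case_nat k (Poly_Mapping.lookup m) i \<noteq> 0} \<subseteq> insert 0 (Suc ` Poly_Mapping.keys m)"
  proof
    fix i assume "i \<in> {i. case_nat k (Poly_Mapping.lookup m) i \<noteq> 0}"
    then show "i \<in> insert 0 (Suc ` Poly_Mapping.keys m)"
      by (cases i) (simp_all add: in_keys_iff)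
  qed
  then have "finite {i. case_nat k (Poly_Mapping.lookup m) i \<noteq> 0}"
    by (rule finite_subset) simp
  then show ?thesis
    by (simp add: mcons_def)
qed

lemma lookup_mcons_simps [simp]:
  "Poly_Mapping.lookup (mcons k m) 0 = k"
  "Poly_Mapping.lookup (mcons k m) (Suc i) = Poly_Mapping.lookup m i"
  by (simp_all add: lookup_mcons)

lemma map_key_Suc_mcons [simp]: "Poly_Mapping.map_key Suc (mcons k m) = m"
  by (rule poly_mapping_eqI) (simp add: map_key.rep_eq)

lemma mcons_collapse [simp]: "mcons (Poly_Mapping.lookup m 0) (Poly_Mapping.map_key Suc m) = m"
  by (rule poly_mapping_eqI) (simp add: map_key.rep_eq lookup_mcons split: nat.split)

lemma mcons_add: "mcons a m + mcons b m' = mcons (a + b) (m + m')"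
  by (rule poly_mapping_eqI) (simp add: lookup_add lookup_mcons split: nat.split)

lemma mcons_eq_iff [simp]: "mcons a m = mcons b m' \<longleftrightarrow> a = b \<and> m = m'"
  by (metis lookup_mcons_simps(1) map_key_Suc_mcons)

lemma mcons_0_0 [simp]: "mcons 0 0 = 0"
  by (rule poly_mapping_eqI) (simp add: lookup_mcons split: nat.split)

lemma mcons_eq_0_iff [simp]: "mcons k m = 0 \<longleftrightarrow> k = 0 \<and> m = 0"
  using mcons_eq_iff [of k m 0 0] unfolding mcons_0_0 .

lemma single_eq_mcons:
  "Poly_Mapping.single 0 k = mcons k 0"
  "Poly_Mapping.single (Suc i) k = mcons 0 (Poly_Mapping.single i k)"
  by (rule poly_mapping_eqI, simp add: lookup_mcons lookup_single split: nat.split)+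

text \<open>Finite support means that stripping leading exponents ends at 0. Coefficients can thus
  be computed one variable at a time.\<close>

lemma mcons_induct [case_names 0 mcons]:
  assumes 0: "P 0" and mcons: "\<And>k m. P m \<Longrightarrow> P (mcons k m)"
  shows "P m"
proof -
  have "(\<forall>i\<ge>n. Poly_Mapping.lookup m i = 0) \<Longrightarrow> P m" for n
  proof (induction n arbitrary: m)
    case 0
    then have "m = 0"
      by (intro poly_mapping_eqI) simp
    with assms show ?case
      by simp
  next
    case (Suc n)
    then have "P (Poly_Mapping.map_key Suc m)"
      by (simp add: map_key.rep_eq)
    from mcons [OF this, of "Poly_Mapping.lookup m 0"] show ?case
      by simp
  qed
  moreover obtain n where "\<forall>i \<in> Poly_Mapping.keys m. i < n"
    using finite_nat_set_iff_bounded [of "Poly_Mapping.keys m"] by auto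
  then have "\<forall>i\<ge>n. Poly_Mapping.lookup m i = 0"
    by (metis in_keys_iff leD)
  ultimately show ?thesis
    by blast
qed

text \<open>The outer sum has the shape of \<open>translate_mult\<close>, which settles products in
  \<open>coeff_to_sym_mcons\<close>.\<close>

lemma coeff_mult_mcons:
  "coeff (f * g) (mcons k m) = (\<Sum>i\<le>k. \<Sum>(a, b) \<in> {(a, b). a + b = m}.
    coeff f (mcons i a) * coeff g (mcons (k - i) b))"
proof -
  have "(\<Sum>i\<le>k. \<Sum>(a, b) \<in> {(a, b). a + b = m}. coeff f (mcons i a) * coeff g (mcons (k - i) b)) =
      (\<Sum>(i, a, b) \<in> {..k} \<times> {(a, b). a + b = m}. coeff f (mcons i a) * coeff g (mcons (k - i) b))"
    by (simp add: sum.cartesian_product case_prod_unfold)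
  also have "\<dots> = (\<Sum>(a, b) \<in> {(a, b). a + b = mcons k m}. coeff f a * coeff g b)"
  proof (rule sum.reindex_bij_witness
      [where i = "\<lambda>(x, y). (Poly_Mapping.lookup x 0, Poly_Mapping.map_key Suc x, Poly_Mapping.map_key Suc y)"
        and j = "\<lambda>(i, a, b). (mcons i a, mcons (k - i) b)"])
    fix p assume "p \<in> {(a, b). a + b = mcons k m}"
    then obtain x y where p: "p = (x, y)" and xy: "x + y = mcons k m"
      by auto
    from arg_cong [OF xy, of "\<lambda>z. Poly_Mapping.lookup z 0"]
    have k: "Poly_Mapping.lookup x 0 + Poly_Mapping.lookup y 0 = k"
      by (simp add: lookup_add)
    then have y: "mcons (k - Poly_Mapping.lookup x 0) (Poly_Mapping.map_key Suc y) = y"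
      by (metis add_diff_cancel_left' mcons_collapse)
    show "(case case p of (x, y) \<Rightarrow>
          (Poly_Mapping.lookup x 0, Poly_Mapping.map_key Suc x, Poly_Mapping.map_key Suc y) of
        (i, a, b) \<Rightarrow> (mcons i a, mcons (k - i) b)) = p"
      by (simp add: p y)
    have "Poly_Mapping.map_key Suc x + Poly_Mapping.map_key Suc y = m"
      using arg_cong [OF xy, of "Poly_Mapping.map_key Suc"] by (simp add: map_key_plus)
    then show "(case p of (x, y) \<Rightarrow>
        (Poly_Mapping.lookup x 0, Poly_Mapping.map_key Suc x, Poly_Mapping.map_key Suc y)) \<in>
        {..k} \<times> {(a, b). a + b = m}"
      using k by (simp add: p)
  qed (auto simp: mcons_add)
  finally show ?thesis
    by (simp add: coeff_mult)
qed

text \<open>Splitting off the first variable \<open>x\<close> turns \<open>p\<^sub>n\<close> into \<open>p\<^sub>n + x\<^sup>n\<close>.\<close>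

lemma coeff_to_sym_mcons: "coeff (to_sym f) (mcons k m) = coeff (to_sym (translate 1 k f)) m"
proof (induction f arbitrary: k m rule: fock_ring_induct)
  case (const c)
  then show ?case
    by (simp add: translate_const to_sym_const coeff_mfps_const coeff_simps)
next
  case (var i)
  have ex: "(\<exists>j. P j) \<longleftrightarrow> P 0 \<or> (\<exists>j. P (Suc j))" for P :: "nat \<Rightarrow> bool"
    by (metis nat.exhaust)
  have "(\<exists>j. mcons k m = Poly_Mapping.single j (Suc i)) \<longleftrightarrow>
      k = Suc i \<and> m = 0 \<or> k = 0 \<and> (\<exists>j. m = Poly_Mapping.single j (Suc i))"
    unfolding ex [of "\<lambda>j. mcons k m = Poly_Mapping.single j (Suc i)"] by (auto simp: single_eq_mcons)
  moreover have "Poly_Mapping.single j (Suc i) \<noteq> 0" for j :: nat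
    by (metis lookup_single_eq lookup_zero nat.distinct(1))
  ultimately show ?case
    by (auto simp: translate_var to_sym_const to_sym_var power_sum_def coeff_mfps_const coeff_simps coeff_one)
next
  case (add f g)
  then show ?case
    by (simp add: to_sym_add translate_add coeff_simps)
next
  case (mult f g)
  then show ?case
    by (simp only: to_sym_mult coeff_mult_mcons translate_mult to_sym_sum coeff_sum)
      (simp only: coeff_mult)
qed

lemma coeff_0_mult: "coeff (f * g) 0 = coeff f 0 * coeff g 0"
proof -
  have "a = 0 \<and> b = 0" if "a + b = 0" for a b :: "nat \<Rightarrow>\<^sub>0 nat"
  proof -
    have "Poly_Mapping.lookup a i + Poly_Mapping.lookup b i = 0" for i
      using arg_cong [OF that, of "\<lambda>m. Poly_Mapping.lookup m i"] by (simp add: lookup_add)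
    then show ?thesis
      by (auto intro!: poly_mapping_eqI)
  qed
  then have "a + b = 0 \<longleftrightarrow> a = 0 \<and> b = 0" for a b :: "nat \<Rightarrow>\<^sub>0 nat"
    by (metis add_0)
  then have "{(a, b). a + b = (0 :: nat \<Rightarrow>\<^sub>0 nat)} = {(0, 0)}"
    by simp
  then show ?thesis
    by (simp add: coeff_mult)
qed

text \<open>Power sums of positive degree have no constant term. This gives the base case of
  arguments by \<open>mcons_induct\<close>.\<close>

lemma coeff_0_to_sym: "coeff (to_sym f) 0 = Poly_Mapping.lookup f 0"
proof -
  have pow: "coeff (p ^ k) 0 = coeff p 0 ^ k" for p :: "rat mfps" and k
    by (induction k) (simp_all add: coeff_0_mult coeff_one)
  have "Poly_Mapping.single j (Suc i) \<noteq> 0" for i j :: nat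
    by (metis lookup_single_eq lookup_zero nat.distinct(1))
  then have "coeff (power_sum (Suc i)) 0 = 0" for i
    by (simp add: power_sum_def)
  then have monomial: "coeff (power_sum_monomial m) 0 = (if m = 0 then 1 else 0)" for m
  proof -
    have "coeff (\<Prod>i \<in> A. power_sum (i + 1) ^ Poly_Mapping.lookup m i) 0 =
        (\<Prod>i \<in> A. 0 ^ Poly_Mapping.lookup m i)" for A
      by (induction A rule: infinite_finite_induct)
        (simp_all add: coeff_one coeff_0_mult pow \<open>\<And>i. coeff (power_sum (Suc i)) 0 = 0\<close>)
    then show ?thesis
      by (auto simp: power_sum_monomial_def in_keys_iff keys_eq_empty [symmetric] simp del: keys_eq_empty)
  qed
  show ?thesis
    by (simp add: to_sym_superset [OF finite_keys order_refl] coeff_sum monomial coeff_0_mult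
        coeff_mfps_const in_keys_iff if_distrib sum.delta [OF finite_keys] cong: if_cong)
qed

section \<open>Degree and symmetry\<close>

lemma monom_degree_0 [simp]: "monom_degree 0 = 0"
  by (simp add: monom_degree_def)

lemma monom_degree_mcons [simp]: "monom_degree (mcons k m) = k + monom_degree m"
proof -
  have "monom_degree (mcons k m) =
      (\<Sum>i \<in> insert 0 (Suc ` Poly_Mapping.keys m). Poly_Mapping.lookup (mcons k m) i)"
    unfolding monom_degree_def
  proof (rule sum.mono_neutral_left)
    show "Poly_Mapping.keys (mcons k m) \<subseteq> insert 0 (Suc ` Poly_Mapping.keys m)"
    proof
      fix i assume "i \<in> Poly_Mapping.keys (mcons k m)"
      then show "i \<in> insert 0 (Suc ` Poly_Mapping.keys m)"
        by (cases i) (simp_all add: in_keys_iff)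
    qed
  qed (simp_all add: in_keys_iff)
  also have "\<dots> = k + monom_degree m"
    by (simp add: sum.reindex monom_degree_def)
  finally show ?thesis .
qed

text \<open>Stripping an exponent \<open>k\<close> applies \<open>translate 1 k\<close>, which
  lowers the weight by \<open>k\<close>; a nonzero constant term at the end forces the remaining
  weight to be 0.\<close>

lemma monom_degree_eq_if_weights_in:
  assumes "weights_in {d} f" "coeff (to_sym f) m \<noteq> 0"
  shows "int (monom_degree m) = d"
  using assms
proof (induction m arbitrary: f d rule: mcons_induct)
  case 0
  then have "0 \<in> Poly_Mapping.keys f"
    by (simp add: coeff_0_to_sym in_keys_iff)
  with 0 show ?case
    by (auto simp: weights_in_def)
next
  case (mcons k m)
  have "weights_in {d - int k} (translate 1 k f)"
    by (rule weights_in_mono [OF weights_in_translate [OF mcons.prems(1)]]) auto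
  from mcons.IH [OF this] mcons.prems(2) show ?case
    by (simp add: coeff_to_sym_mcons)
qed

lemma coeff_to_sym_permute:
  assumes "bij \<pi>"
  shows "coeff (to_sym f) (Poly_Mapping.map_key \<pi> m) = coeff (to_sym f) m"
proof (induction f arbitrary: m rule: fock_ring_induct)
  have inj: "inj \<pi>" "inj (inv \<pi>)"
    using assms by (auto simp: bij_is_inj bij_imp_bij_inv)
  have inv: "Poly_Mapping.map_key (inv \<pi>) (Poly_Mapping.map_key \<pi> m) = m"
      "Poly_Mapping.map_key \<pi> (Poly_Mapping.map_key (inv \<pi>) m) = m" for m :: "nat \<Rightarrow>\<^sub>0 nat"
    using assms inj
    by (auto intro!: poly_mapping_eqI simp: map_key.rep_eq bij_is_surj surj_f_inv_f)
  have single: "Poly_Mapping.map_key \<pi> (Poly_Mapping.single i k) = Poly_Mapping.single (inv \<pi> i) k"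
    for i and k :: nat
    using map_key_single [OF inj(1), of "inv \<pi> i" k] assms by (simp add: bij_is_surj surj_f_inv_f)
  {
    case (const c)
    then show ?case
      by (metis coeff_mfps_const inv(1) map_key_zero inj to_sym_const)
  next
    case (var i)
    have "(\<exists>j. Poly_Mapping.map_key \<pi> m = Poly_Mapping.single j (Suc i)) \<longleftrightarrow>
        (\<exists>j. m = Poly_Mapping.single j (Suc i))"
      by (metis inv single map_key_single inj)
    then show ?case
      by (simp add: to_sym_var power_sum_def)
  next
    case (add f g)
    then show ?case
      by (simp add: to_sym_add coeff_simps)
  next
    case (mult f g)
    have inv_coeff: "coeff (to_sym f) (Poly_Mapping.map_key (inv \<pi>) m) = coeff (to_sym f) m"
      "coeff (to_sym g) (Poly_Mapping.map_key (inv \<pi>) m) = coeff (to_sym g) m" for m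
      using mult [of "Poly_Mapping.map_key (inv \<pi>) m"] by (simp_all add: inv)
    show ?case
      unfolding to_sym_mult coeff_mult
      by (rule sum.reindex_bij_witness
          [where i = "map_prod (Poly_Mapping.map_key \<pi>) (Poly_Mapping.map_key \<pi>)"
            and j = "map_prod (Poly_Mapping.map_key (inv \<pi>)) (Poly_Mapping.map_key (inv \<pi>))"])
        (auto simp: inv inv_coeff map_key_plus [OF inj(1), symmetric] map_key_plus [OF inj(2), symmetric])
  }
qed


section \<open>Integrality\<close>

text \<open>Integrality concerns coefficients of monomials in the variables, not of power sum
  products: \<open>h_2 = (p_1^2 + p_2) / 2\<close> is integral in this sense.\<close>

definition integral_fock :: "fock \<Rightarrow> bool" where
  "integral_fock f \<longleftrightarrow> (\<forall>m. coeff (to_sym f) m \<in> \<int>)"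

lemma integral_fock_1: "integral_fock 1"
  and integral_fock_uminus: "integral_fock f \<Longrightarrow> integral_fock (- f)"
  and integral_fock_mult: "integral_fock f \<Longrightarrow> integral_fock g \<Longrightarrow> integral_fock (f * g)"
  and integral_fock_sum: "(\<And>x. x \<in> A \<Longrightarrow> integral_fock (F x)) \<Longrightarrow> integral_fock (sum F A)"
  by (auto simp: integral_fock_def coeff_simps coeff_one to_sym_uminus to_sym_mult to_sym_sum
      coeff_sum coeff_mult case_prod_unfold)

text \<open>Stripping a variable turns \<open>h_a\<close> into \<open>h_(a-k)\<close>, so every
  coefficient reduces to a constant term, which is 0 or 1.\<close>

lemma integral_fock_complete: "integral_fock (fock_complete a)"
proof -
  have "coeff (to_sym (fock_complete a)) m \<in> \<int>" for m
  proof (induction m arbitrary: a rule: mcons_induct)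
    case 0
    show ?case
      using monom_degree_eq_if_weights_in [OF weights_in_fock_complete, of a 0]
      by (cases "a = 0"; cases "coeff (to_sym (fock_complete a)) 0 = 0") (simp_all add: coeff_one)
  next
    case (mcons k m)
    then show ?case
      by (simp add: coeff_to_sym_mcons translate_fock_complete)
  qed
  then show ?thesis
    by (simp add: integral_fock_def)
qed

lemma integral_fock_translate: "integral_fock f \<Longrightarrow> integral_fock (translate 1 k f)"
  by (simp add: integral_fock_def coeff_to_sym_mcons [symmetric])

text \<open>\<open>translate_inverse\<close> expresses \<open>translate (- 1) n\<close> without
  division by earlier coefficients composed with \<open>translate 1\<close>. The latter preserves
  integrality because it only selects coefficients of \<open>f\<close>.\<close>

lemma integral_fock_translate_inverse: "integral_fock f \<Longrightarrow> integral_fock (translate (- 1) n f)"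
proof (induction n arbitrary: f rule: less_induct)
  case (less n)
  show ?case
  proof (cases "n = 0")
    case False
    have "(\<Sum>i\<le>n. translate (- 1) i (translate 1 (n - i) f)) =
        (\<Sum>i<n. translate (- 1) i (translate 1 (n - i) f)) + translate (- 1) n f"
      by (simp add: lessThan_Suc_atMost [symmetric])
    then have "translate (- 1) n f = - (\<Sum>i<n. translate (- 1) i (translate 1 (n - i) f))"
      using False translate_inverse [of 1 n f] by (simp add: eq_neg_iff_add_eq_0 add.commute)
    with less show ?thesis
      by (auto intro!: integral_fock_uminus integral_fock_sum integral_fock_translate)
  qed (use less in simp)
qed

lemma integral_fock_schur_fock: "integral_fock (schur_fock \<nu>)"
proof (induction \<nu>)
  case (Cons a \<nu>)
  obtain d where "weights_in {..int d} (schur_fock \<nu>)"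
    by (rule obtain_weight_bound)
  with Cons show ?case
    by (auto simp: vertex_S_eq_sum intro!: integral_fock_sum integral_fock_mult
        integral_fock_complete integral_fock_translate_inverse)
qed (simp add: integral_fock_1)

lemma monom_degree_schur:
  "coeff (schur \<nu>) m \<noteq> 0 \<Longrightarrow> int (monom_degree m) = sum_list \<nu>"
  unfolding schur_eq_to_sym by (rule monom_degree_eq_if_weights_in [OF weights_in_schur_fock])

lemma schur_in_Lambda: "schur \<nu> \<in> Lambda"
proof -
  have "monom_degree m \<le> nat (sum_list \<nu>)" if "coeff (schur \<nu>) m \<noteq> 0" for m
    using monom_degree_schur [OF that] by simp
  then show ?thesis
    using integral_fock_schur_fock [of \<nu>]
    by (auto simp: Lambda_def schur_eq_to_sym coeff_to_sym_permute integral_fock_def)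
qed


section \<open>Unitriangularity\<close>

text \<open>Under the hypothesis the sum in \<open>translate_vertex_S\<close> already contains all
  nonzero terms of \<open>vertex_S_mult\<close> for the product with first factor 1, and a vertex
  operator applied to 1 gives a complete function.\<close>

lemma translate_vertex_S_top:
  assumes "\<And>j. j > k \<Longrightarrow> translate 1 j f = 0"
  shows "translate 1 k (vertex_S (- a) f) = fock_complete (a - int k) * f"
proof -
  obtain d where "weights_in {..int d} f"
    by (rule obtain_weight_bound)
  \<comment> \<open>The bound has to be at least \<open>k\<close>, so that the sum up to
    \<open>k\<close> can be extended to it.\<close>
  then have bound: "weights_in {..int (k + d)} f"
    by (rule weights_in_mono) auto
  have "translate 1 k (vertex_S (- a) f) =
      (\<Sum>i\<le>k. vertex_S (- (a - int i)) (translate 1 (k - i) f))"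
    by (rule translate_vertex_S)
  also have "\<dots> = (\<Sum>j\<le>k. vertex_S (- (a - int (k - j))) (translate 1 j f))"
    by (rule sum.reindex_bij_witness [where i = "\<lambda>j. k - j" and j = "\<lambda>j. k - j"]) auto
  also have "\<dots> = (\<Sum>j\<le>k. vertex_S (- (a - int k + int j)) (1 * translate 1 j f))"
    by (rule sum.cong) (simp_all add: of_nat_diff algebra_simps)
  also have "\<dots> = (\<Sum>j\<le>k + d. vertex_S (- (a - int k + int j)) (1 * translate 1 j f))"
    by (rule sum.mono_neutral_left) (auto simp: assms fock_linear_0 [OF fock_linear_vertex_S])
  also have "\<dots> = vertex_S (- (a - int k)) 1 * f"
    by (rule vertex_S_mult [OF bound, symmetric])
  also have "vertex_S (- (a - int k)) 1 = fock_complete (a - int k)"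
    by (subst vertex_S_eq_sum [of 0]) (simp_all add: weights_in_one)
  finally show ?thesis .
qed

text \<open>The factor \<open>h_(a-k)\<close> of \<open>translate_vertex_S_top\<close> has negative
  index; its hypothesis on all \<open>j > k\<close> is the induction hypothesis.
  \<open>k > 0\<close> excludes the identity \<open>translate 1 0\<close>.\<close>

lemma translate_schur_fock_eq_0:
  "\<lbrakk>\<forall>a \<in> set lam. a < int k; k > 0\<rbrakk> \<Longrightarrow> translate 1 k (schur_fock lam) = 0"
proof (induction lam arbitrary: k)
  case (Cons a lam)
  have "translate 1 j (schur_fock lam) = 0" if "j > k" for j
    by (rule Cons.IH) (use Cons.prems that in auto)
  from translate_vertex_S_top [OF this, of k a] Cons.prems show ?case
    by simp
qed (simp add: translate_one)

text \<open>At \<open>k = a\<close> the remaining factor is \<open>h_0 = 1\<close>.\<close>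

lemma translate_schur_fock_hd:
  assumes "\<forall>b \<in> set lam. b \<le> a" "a \<ge> 0"
  shows "translate 1 (nat a) (schur_fock (a # lam)) = schur_fock lam"
proof -
  have "translate 1 j (schur_fock lam) = 0" if "j > nat a" for j
    by (rule translate_schur_fock_eq_0) (use assms that in force)+
  from translate_vertex_S_top [OF this, of "nat a" a] assms(2) show ?thesis
    by simp
qed

section \<open>Leading monomials and linear independence\<close>

definition list_monomial :: "int list \<Rightarrow> (nat \<Rightarrow>\<^sub>0 nat)" where
  "list_monomial \<mu> = foldr (\<lambda>a m. mcons (nat a) m) \<mu> 0"

lemma list_monomial_simps [simp]:
  "list_monomial [] = 0"
  "list_monomial (a # \<mu>) = mcons (nat a) (list_monomial \<mu>)"
  by (simp_all add: list_monomial_def)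

lemma partitions_Nil [simp]: "[] \<in> partitions"
  and partitions_Cons: "a # lam \<in> partitions \<longleftrightarrow> a > 0 \<and> (\<forall>b \<in> set lam. b \<le> a) \<and> lam \<in> partitions"
  by (auto simp: partitions_def)

lemma coeff_schur_diag: "lam \<in> partitions \<Longrightarrow> coeff (schur lam) (list_monomial lam) = 1"
  by (induction lam)
    (simp_all add: schur_eq_to_sym coeff_one partitions_Cons coeff_to_sym_mcons
      translate_schur_fock_hd del: schur_fock_simps(2))

text \<open>The order on lists is lexicographic. If \<open>\<mu>\<close> has the larger first entry
  the coefficient vanishes, and equal first entries can be stripped from both lists.\<close>

lemma coeff_schur_neq_0_imp_le:
  assumes "lam \<in> partitions" "\<mu> \<in> partitions" "coeff (schur lam) (list_monomial \<mu>) \<noteq> 0"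
  shows "\<mu> \<le> lam"
  using assms
proof (induction \<mu> arbitrary: lam)
  case (Cons b \<mu>)
  have b: "b > 0" "\<mu> \<in> partitions"
    using Cons.prems by (auto simp: partitions_Cons)
  have nz: "coeff (to_sym (translate 1 (nat b) (schur_fock lam))) (list_monomial \<mu>) \<noteq> 0"
    using Cons.prems(3) by (simp add: schur_eq_to_sym coeff_to_sym_mcons)
  show ?case
  proof (cases lam)
    case Nil
    then show ?thesis
      using nz b by (simp add: translate_one coeff_simps)
  next
    case (Cons a lam')
    have a: "a > 0" "\<forall>c \<in> set lam'. c \<le> a" "lam' \<in> partitions"
      using Cons \<open>lam \<in> partitions\<close> by (auto simp: partitions_Cons)
    have "\<not> a < b"
    proof
      assume "a < b"
      then have "translate 1 (nat b) (schur_fock lam) = 0"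
        using a b by (intro translate_schur_fock_eq_0) (auto simp: Cons)
      with nz show False
        by (simp add: coeff_simps)
    qed
    moreover have "\<mu> \<le> lam'" if "a = b"
    proof -
      have "translate 1 (nat b) (schur_fock lam) = schur_fock lam'"
        unfolding Cons that [symmetric] by (rule translate_schur_fock_hd) (use a in auto)
      with nz have "coeff (schur lam') (list_monomial \<mu>) \<noteq> 0"
        by (simp add: schur_eq_to_sym)
      with a b show ?thesis
        by (intro Cons.IH)
    qed
    ultimately show ?thesis
      by (auto simp: Cons)
  qed
qed simp

lemma inj_on_schur: "inj_on schur partitions"
proof (rule inj_onI)
  fix lam \<mu> assume "lam \<in> partitions" "\<mu> \<in> partitions" "schur lam = schur \<mu>"
  then show "lam = \<mu>"
    by (metis antisym coeff_schur_diag coeff_schur_neq_0_imp_le zero_neq_one)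
qed

lemma coeff_int_scale: "coeff (int_scale c f) m = of_int c * coeff f m"
proof -
  have "of_nat n = (mfps_const (of_nat n) :: rat mfps)" for n
    by (induction n) (simp_all add: mfps_const_add)
  moreover have "mfps_const (- c) = - mfps_const c" for c :: rat
    by (rule mfps_eqI) (simp add: coeff_mfps_const coeff_simps)
  ultimately have "of_int c = (mfps_const (of_int c) :: rat mfps)"
    by (cases c rule: int_cases2) simp_all
  then show ?thesis
    by (simp add: int_scale_def coeff_mfps_const_mult)
qed

text \<open>In a relation, compare coefficients at the monomial of the largest partition that
  occurs: by \<open>coeff_schur_neq_0_imp_le\<close> the other Schur functions vanish there.\<close>

lemma independent_schur: "int_mod.independent (schur ` partitions)"
proof
  assume "int_mod.dependent (schur ` partitions)"
  then obtain t u where t: "finite t" "t \<subseteq> schur ` partitions" "(\<Sum>v \<in> t. int_scale (u v) v) = 0"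
    and "\<exists>v \<in> t. u v \<noteq> 0"
    unfolding int_mod.dependent_explicit by auto
  define T where "T = {lam \<in> partitions. schur lam \<in> t \<and> u (schur lam) \<noteq> 0}"
  have "finite T"
  proof (rule finite_imageD)
    show "finite (schur ` T)"
      by (rule finite_subset [OF _ t(1)]) (auto simp: T_def)
    show "inj_on schur T"
      by (rule inj_on_subset [OF inj_on_schur]) (auto simp: T_def)
  qed
  moreover have "T \<noteq> {}"
    using t(2) \<open>\<exists>v \<in> t. u v \<noteq> 0\<close> by (auto simp: T_def)
  ultimately have lam: "Max T \<in> T" and max: "\<And>\<mu>. \<mu> \<in> T \<Longrightarrow> \<mu> \<le> Max T"
    by auto
  define lam where "lam = Max T"
  have lamT: "lam \<in> partitions" "schur lam \<in> t" "u (schur lam) \<noteq> 0"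
    using lam by (auto simp: lam_def T_def)
  have "of_int (u v) * coeff v (list_monomial lam) = 0" if v: "v \<in> t - {schur lam}" for v
  proof (rule ccontr)
    assume nz: "of_int (u v) * coeff v (list_monomial lam) \<noteq> 0"
    obtain \<mu> where \<mu>: "\<mu> \<in> partitions" "v = schur \<mu>"
      using v t(2) by auto
    with nz v have "\<mu> \<in> T"
      by (auto simp: T_def)
    then have "\<mu> \<le> lam"
      unfolding lam_def by (rule max)
    moreover have "lam \<le> \<mu>"
      using nz \<mu> lamT(1) by (intro coeff_schur_neq_0_imp_le) auto
    ultimately show False
      using v \<mu> by auto
  qed
  then have "(\<Sum>v \<in> t - {schur lam}. of_int (u v) * coeff v (list_monomial lam)) = 0"
    by (rule sum.neutral [OF ballI])
  then have "(\<Sum>v \<in> t. of_int (u v) * coeff v (list_monomial lam)) =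
      of_int (u (schur lam)) * coeff (schur lam) (list_monomial lam)"
    using t(1) lamT(2) by (subst sum.remove [of t "schur lam"]) simp_all
  moreover have "(\<Sum>v \<in> t. of_int (u v) * coeff v (list_monomial lam)) = 0"
    using arg_cong [OF t(3), of "\<lambda>f. coeff f (list_monomial lam)"]
    by (simp add: coeff_sum coeff_int_scale coeff_simps)
  ultimately show False
    using lamT by (simp add: coeff_schur_diag)
qed


section \<open>The Schur functions span\<close>

text \<open>\<open>T - S\<close> and \<open>S - T\<close> have equal size, so \<open>g\<close> is
  completed by a bijection between them and the identity elsewhere. The symmetry in
  \<open>Lambda\<close> speaks of permutations of all indices, while sorting a monomial prescribes
  only finitely many values.\<close>

lemma ex_bij_extending:
  fixes g :: "'a \<Rightarrow> 'a"
  assumes "bij_betw g S T" "finite S"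
  obtains \<pi> where "bij \<pi>" "\<And>x. x \<in> S \<Longrightarrow> \<pi> x = g x"
proof -
  have fin: "finite T" "card S = card T"
    using assms bij_betw_finite bij_betw_same_card by blast+
  then have "card (T - S) = card (S - T)"
    using assms(2) by (simp add: card_Diff_subset_Int Int_commute)
  then obtain h where h: "bij_betw h (T - S) (S - T)"
    using assms(2) fin(1) finite_same_card_bij by blast
  define \<pi> where "\<pi> x = (if x \<in> S then g x else if x \<in> T then h x else x)" for x
  have "bij_betw \<pi> S T"
    by (rule bij_betw_cong [THEN iffD2, OF _ assms(1)]) (simp add: \<pi>_def)
  moreover have "bij_betw \<pi> (T - S) (S - T)"
    by (rule bij_betw_cong [THEN iffD2, OF _ h]) (simp add: \<pi>_def)
  ultimately have "bij_betw \<pi> (S \<union> (T - S)) (T \<union> (S - T))"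
    by (rule bij_betw_combine) auto
  moreover have "bij_betw \<pi> (- (S \<union> T)) (- (S \<union> T))"
    by (rule bij_betw_cong [THEN iffD2, OF _ bij_betw_id]) (simp add: \<pi>_def)
  ultimately have "bij_betw \<pi> (S \<union> (T - S) \<union> - (S \<union> T)) (T \<union> (S - T) \<union> - (S \<union> T))"
    by (rule bij_betw_combine) auto
  moreover have "S \<union> (T - S) \<union> - (S \<union> T) = UNIV" "T \<union> (S - T) \<union> - (S \<union> T) = UNIV"
    by auto
  ultimately have "bij \<pi>"
    by simp
  then show ?thesis
    by (rule that) (simp add: \<pi>_def)
qed

lemma lookup_list_monomial:
  "Poly_Mapping.lookup (list_monomial \<mu>) i = (if i < length \<mu> then nat (\<mu> ! i) else 0)"
  by (induction \<mu> arbitrary: i) (auto simp: lookup_mcons split: nat.split)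

lemma monom_degree_list_monomial:
  "\<mu> \<in> partitions \<Longrightarrow> int (monom_degree (list_monomial \<mu>)) = sum_list \<mu>"
  by (induction \<mu>) (simp_all add: partitions_Cons)

lemma obtain_partition_of_monomial:
  fixes m :: "nat \<Rightarrow>\<^sub>0 nat"
  obtains \<pi> \<mu> where "bij \<pi>" "\<mu> \<in> partitions" "Poly_Mapping.map_key \<pi> m = list_monomial \<mu>"
proof -
  \<comment> \<open>Negated exponents as keys order the variables by weakly decreasing
    exponent.\<close>
  define ks where "ks = sort_key (\<lambda>i. - int (Poly_Mapping.lookup m i)) (sorted_list_of_set (Poly_Mapping.keys m))"
  define \<mu> where "\<mu> = map (\<lambda>i. int (Poly_Mapping.lookup m i)) ks"
  have ks: "distinct ks" "set ks = Poly_Mapping.keys m"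
    by (simp_all add: ks_def)
  have "sorted (map (\<lambda>i. - int (Poly_Mapping.lookup m i)) ks)"
    by (simp add: ks_def)
  then have "\<mu> \<in> partitions"
    using ks(2) by (auto simp: partitions_def \<mu>_def sorted_wrt_map in_keys_iff)
  have "bij_betw (\<lambda>i. ks ! i) {..<length ks} (Poly_Mapping.keys m)"
    using ks by (intro bij_betw_nth) auto
  then obtain \<pi> where \<pi>: "bij \<pi>" "\<And>i. i \<in> {..<length ks} \<Longrightarrow> \<pi> i = ks ! i"
    by (rule ex_bij_extending) auto
  \<comment> \<open>All variables of \<open>m\<close> are hit by positions below
    \<open>length ks\<close>, so injectivity leaves exponent 0 further on.\<close>
  have "\<pi> i \<notin> Poly_Mapping.keys m" if "i \<ge> length ks" for i
  proof
    assume "\<pi> i \<in> Poly_Mapping.keys m"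
    then obtain j where "j < length ks" "\<pi> i = ks ! j"
      using ks(2) by (metis in_set_conv_nth)
    with \<pi> have "\<pi> i = \<pi> j"
      by simp
    then have "i = j"
      using \<pi>(1) by (simp add: bij_is_inj inj_eq)
    with \<open>j < length ks\<close> that show False
      by simp
  qed
  then have "Poly_Mapping.map_key \<pi> m = list_monomial \<mu>"
    using \<pi> by (intro poly_mapping_eqI)
      (auto simp: map_key.rep_eq bij_is_inj lookup_list_monomial \<mu>_def in_keys_iff)
  with \<pi>(1) \<open>\<mu> \<in> partitions\<close> show ?thesis
    by (rule that)
qed

lemma Lambda_eq_0:
  assumes "f \<in> Lambda" "\<And>\<mu>. \<mu> \<in> partitions \<Longrightarrow> coeff f (list_monomial \<mu>) = 0"
  shows "f = 0"
proof (rule mfps_eqI)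
  fix m :: "nat \<Rightarrow>\<^sub>0 nat"
  obtain \<pi> \<mu> where "bij \<pi>" "\<mu> \<in> partitions" "Poly_Mapping.map_key \<pi> m = list_monomial \<mu>"
    by (rule obtain_partition_of_monomial [of m])
  with assms have "coeff f m = 0"
    unfolding Lambda_def by (metis (mono_tags, lifting) mem_Collect_eq)
  then show "coeff f m = coeff 0 m"
    by (simp add: coeff_simps)
qed

lemma Lambda_add: "f \<in> Lambda \<Longrightarrow> g \<in> Lambda \<Longrightarrow> f + g \<in> Lambda"
proof -
  assume f: "f \<in> Lambda" and g: "g \<in> Lambda"
  obtain d e where "\<forall>m. coeff f m \<noteq> 0 \<longrightarrow> monom_degree m \<le> d" "\<forall>m. coeff g m \<noteq> 0 \<longrightarrow> monom_degree m \<le> e"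
    using f g by (auto simp: Lambda_def)
  then have "\<forall>m. coeff (f + g) m \<noteq> 0 \<longrightarrow> monom_degree m \<le> max d e"
    by (metis add.right_neutral coeff_simps(2) le_max_iff_disj)
  with f g show "f + g \<in> Lambda"
    unfolding Lambda_def by (auto simp: coeff_simps)
qed

lemma Lambda_int_scale: "f \<in> Lambda \<Longrightarrow> int_scale c f \<in> Lambda"
  by (auto simp: Lambda_def coeff_int_scale)

lemma subspace_Lambda: "int_mod.subspace Lambda"
  by (rule int_mod.subspaceI) (auto simp: Lambda_add Lambda_int_scale, auto simp: Lambda_def coeff_simps)

lemma finite_partitions_sum_le: "finite {\<mu> \<in> partitions. sum_list \<mu> \<le> int d}"
proof (rule finite_subset)
  have "length \<mu> \<le> d \<and> set \<mu> \<subseteq> {0..int d}" if "\<mu> \<in> partitions" "sum_list \<mu> \<le> int d" for \<mu> d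
  proof -
    have "int (length \<mu>) \<le> sum_list \<mu> \<and> (\<forall>x \<in> set \<mu>. 0 \<le> x \<and> x \<le> sum_list \<mu>)"
      using that(1) by (induction \<mu>) (auto simp: partitions_Cons)
    with that(2) show ?thesis
      by auto
  qed
  then show "{\<mu> \<in> partitions. sum_list \<mu> \<le> int d} \<subseteq> {\<mu>. set \<mu> \<subseteq> {0..int d} \<and> length \<mu> \<le> d}"
    by auto
qed (rule finite_lists_length_le, simp)

text \<open>
  Subtracting from \<open>f\<close> a multiple of the Schur function of its largest partition in the
  lexicographic order only introduces smaller partitions.
\<close>

lemma Lambda_subset_span: "Lambda \<subseteq> int_mod.span (schur ` partitions)"
proof
  fix f assume "f \<in> Lambda"
  then obtain d where d: "\<forall>m. coeff f m \<noteq> 0 \<longrightarrow> monom_degree m \<le> d"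
    by (auto simp: Lambda_def)
  define X where "X = {\<mu> \<in> partitions. sum_list \<mu> \<le> int d}"
  have "finite X"
    unfolding X_def by (rule finite_partitions_sum_le)
  \<comment> \<open>\<open>A\<close> is downward closed in \<open>X\<close> and contains every
    partition whose monomial occurs in \<open>f\<close>; each subtraction removes its largest
    element.\<close>
  have *: "f \<in> int_mod.span (schur ` partitions)"
    if "finite A" "A \<subseteq> X" "\<And>\<mu> \<nu>. \<mu> \<in> X \<Longrightarrow> \<nu> \<in> A \<Longrightarrow> \<mu> \<le> \<nu> \<Longrightarrow> \<mu> \<in> A"
      "f \<in> Lambda" "\<And>\<mu>. \<mu> \<in> partitions \<Longrightarrow> coeff f (list_monomial \<mu>) \<noteq> 0 \<Longrightarrow> \<mu> \<in> A" for A f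
    using that
  proof (induction A arbitrary: f rule: finite_linorder_max_induct)
    case empty
    then have "f = 0"
      by (intro Lambda_eq_0) auto
    then show ?case
      by (simp add: int_mod.span_zero)
  next
    case (insert b A)
    have b: "b \<in> partitions" "b \<in> X"
      using insert.prems(1) by (auto simp: X_def)
    \<comment> \<open>Integrality of the coefficients in \<open>Lambda\<close> makes the multiple to
      be subtracted an integer one.\<close>
    have "coeff f (list_monomial b) \<in> \<int>"
      using insert.prems(3) by (simp add: Lambda_def)
    then obtain c where c: "coeff f (list_monomial b) = of_int c"
      by (rule Ints_cases)
    define g where "g = f + int_scale (- c) (schur b)"
    have coeff_g: "coeff g m = coeff f m - of_int c * coeff (schur b) m" for m
      by (simp add: g_def coeff_simps coeff_int_scale)
    have "g \<in> int_mod.span (schur ` partitions)"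
    proof (rule insert.IH)
      show "A \<subseteq> X"
        using insert.prems(1) by simp
      \<comment> \<open>Everything below an element of \<open>A\<close> is smaller than
        \<open>b\<close>, so removing \<open>b\<close> preserves downward closure.\<close>
      show "\<mu> \<in> A" if "\<mu> \<in> X" "\<nu> \<in> A" "\<mu> \<le> \<nu>" for \<mu> \<nu>
        using insert.prems(2) [of \<mu> \<nu>] insert.hyps(2) that by force
      show "g \<in> Lambda"
        unfolding g_def by (intro Lambda_add Lambda_int_scale insert.prems schur_in_Lambda)
      fix \<mu> assume \<mu>: "\<mu> \<in> partitions" "coeff g (list_monomial \<mu>) \<noteq> 0"
      have "\<mu> \<noteq> b"
        using \<mu>(2) b(1) by (auto simp: coeff_g c coeff_schur_diag)
      moreover have "\<mu> \<in> insert b A"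
      proof (cases "coeff f (list_monomial \<mu>) = 0")
        case True
        with \<mu>(2) have nz: "coeff (schur b) (list_monomial \<mu>) \<noteq> 0"
          by (auto simp: coeff_g)
        then have "\<mu> \<le> b"
          by (intro coeff_schur_neq_0_imp_le b \<mu>)
        \<comment> \<open>Homogeneity of \<open>schur b\<close> keeps newly introduced partitions
          inside \<open>X\<close>.\<close>
        moreover have "sum_list \<mu> = sum_list b"
          using monom_degree_schur [OF nz] \<mu>(1) by (simp add: monom_degree_list_monomial)
        ultimately show ?thesis
          using insert.prems(2) [of \<mu> b] \<mu>(1) b by (simp add: X_def)
      qed (use insert.prems(4) \<mu>(1) in auto)
      ultimately show "\<mu> \<in> A"
        by simp
    qed
    moreover have "f = g + int_scale c (schur b)"
      by (simp add: g_def int_scale_def)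
    ultimately show ?case
      using b(1) by (auto intro: int_mod.span_add int_mod.span_scale int_mod.span_base)
  qed
  show "f \<in> int_mod.span (schur ` partitions)"
  proof (rule * [OF \<open>finite X\<close> order_refl _ \<open>f \<in> Lambda\<close>])
    fix \<mu> assume \<mu>: "\<mu> \<in> partitions" "coeff f (list_monomial \<mu>) \<noteq> 0"
    then have "int (monom_degree (list_monomial \<mu>)) \<le> int d"
      using d by simp
    with \<mu>(1) show "\<mu> \<in> X"
      by (simp add: X_def monom_degree_list_monomial)
  qed
qed

theorem proposition2p2:
  shows "(\<forall>lam \<in> partitions. \<forall>\<mu> \<in> partitions. \<forall>m n. length lam = m \<and> length \<mu> = n \<longrightarrow>
      (let term = (\<lambda>(M, N). of_nat (matrix_count M N) * schur (shifted lam \<mu> M N));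
           I = {x \<in> tuples m \<times> tuples n. term x \<noteq> 0}
       in finite I \<and> schur lam * schur \<mu> = (\<Sum>x \<in> I. term x)))
    \<and> (inj_on schur partitions
       \<and> int_mod.independent (schur ` partitions)
       \<and> int_mod.span (schur ` partitions) = Lambda)"
proof (intro conjI)
  show "int_mod.span (schur ` partitions) = Lambda"
    by (intro antisym int_mod.span_minimal subspace_Lambda Lambda_subset_span)
      (auto simp: schur_in_Lambda)
qed (auto simp: Let_def schur_mult inj_on_schur independent_schur)

end
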